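(* Let $\mathcal{G}$ denote the family of all finite groups and let $\mathrm{Pr}(\mathcal{G}) = \{\mathrm{Pr}(G) : G \in \mathcal{G}\}$ be the set of commuting probabilities of finite groups. If $l \in \left( \frac{2}{9}, 1 \right]$ is a limit point of the set $\mathrm{Pr}(\mathcal{G})$, then (i) $l \in \mathbb{Q}$, and (ii) there exists an $\epsilon = \epsilon_l > 0$ such that $\mathrm{Pr}(\mathcal{G}) \cap (l - \epsilon_l, l) = \emptyset$.
   Context: For a finite group $G$, the commuting probability is $$\mathrm{Pr}(G) := \frac{\#\{(x,y) \in G \times G : xy = yx\}}{|G|^2}.$$ Convention: a limit point of a set $S \subseteq \mathbb{R}$ is an element $l \in \mathbb{R}$ such that there is a sequence $(s_n)$ of elements of $S$ (not required to be distinct or different from $l$) tending to $l$. In particular, every element of $S$ is itself a limit point of $S$. *)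

theory Defs
  imports Complex_Main "HOL-Algebra.Coset"
begin

definition commuting_prob :: "('a, 'm) monoid_scheme \<Rightarrow> real" where
  "commuting_prob G =
     real (card {(x, y). x \<in> carrier G \<and> y \<in> carrier G \<and> x \<otimes>\<^bsub>G\<^esub> y = y \<otimes>\<^bsub>G\<^esub> x})
       / (real (order G))\<^sup>2"

text \<open>
  HOL cannot quantify over all types inside a set comprehension, so the family of all finite groups
  is represented by the groups whose carrier is a finite set of natural numbers. Every
  finite group is isomorphic to one of these; the lemma \<open>commuting_prob_in_set\<close> below confirms that
  no value is lost.
\<close>

definition commuting_probs :: "real set" where
  "commuting_probs = {commuting_prob G | G :: nat monoid. group G \<and> finite (carrier G)}"

text \<open>
  The sequence may be constant, so every element of \<open>S\<close> is a limit point of \<open>S\<close>; this differs from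
  the library's \<open>islimpt\<close>.
\<close>

definition is_limit_point :: "real \<Rightarrow> real set \<Rightarrow> bool" where
  "is_limit_point l S \<longleftrightarrow> (\<exists>s :: nat \<Rightarrow> real. (\<forall>n. s n \<in> S) \<and> s \<longlonglongrightarrow> l)"

lemma commuting_prob_in_set:
  fixes G :: "('a, 'm) monoid_scheme"
  assumes "group G" and fin: "finite (carrier G)"
  shows "commuting_prob G \<in> commuting_probs"
proof -
  interpret group G by fact
  obtain f :: "'a \<Rightarrow> nat" where f: "inj_on f (carrier G)"
    using finite_imp_inj_to_nat_seg[OF fin] by blast
  define g where "g = inv_into (carrier G) f"
  have g [simp]: "g (f x) = x" if "x \<in> carrier G" for x
    using f that by (simp add: g_def)
  have f_eq [simp]: "f x = f y \<longleftrightarrow> x = y" if "x \<in> carrier G" "y \<in> carrier G" for x y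
    using f that by (auto dest: inj_onD)
  define H :: "nat monoid" where
    "H = \<lparr>carrier = f ` carrier G, mult = (\<lambda>a b. f (g a \<otimes>\<^bsub>G\<^esub> g b)), one = f \<one>\<^bsub>G\<^esub>\<rparr>"
  have H: "group H"
    by (rule groupI) (auto simp: H_def m_assoc intro!: bexI[of _ "inv\<^bsub>G\<^esub> _"])
  let ?C = "{(x, y). x \<in> carrier G \<and> y \<in> carrier G \<and> x \<otimes>\<^bsub>G\<^esub> y = y \<otimes>\<^bsub>G\<^esub> x}"
  let ?D = "{(x, y). x \<in> carrier H \<and> y \<in> carrier H \<and> x \<otimes>\<^bsub>H\<^esub> y = y \<otimes>\<^bsub>H\<^esub> x}"
  have "?D = map_prod f f ` ?C"
    by (fastforce simp: H_def)
  moreover have "inj_on (map_prod f f) ?C"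
    by (auto simp: inj_on_def)
  ultimately have "card ?D = card ?C"
    by (simp add: card_image)
  moreover have "order H = order G"
    using f by (simp add: order_def H_def card_image)
  ultimately have "commuting_prob G = commuting_prob H"
    unfolding commuting_prob_def by simp
  moreover have "finite (carrier H)"
    using fin by (simp add: H_def)
  ultimately show ?thesis
    using H unfolding commuting_probs_def by blast
qed

end

theory Submission
  imports Defs "HOL-Library.Infinite_Set"
begin

text \<open>
  For a normal subgroup \<open>N\<close> let \<open>q\<close> be the probability that a random commutator lies in \<open>N\<close>, that
  is, the commuting probability of \<open>G / N\<close>. Then \<open>q / |N| \<le> Pr(G)\<close>, with equality up to the density
  of those \<open>x\<close> for which some element of \<open>N\<close> is not of the form \<open>[x, y]\<close>. If the centre of \<open>G / N\<close>
  has bounded index, then \<open>q\<close> takes only finitely many, rational values; and if that exceptional set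
  of \<open>x\<close> is not small, then \<open>N\<close> can be replaced by a smaller normal subgroup with the same
  property (with a worse bound). Along a sequence of groups in which \<open>|N|\<close> is bounded and chosen
  minimal, the exceptional density therefore tends to \<open>0\<close>, so \<open>Pr(G)\<close> tends to some \<open>q / |N|\<close>, and it
  does so from above.

  Such an \<open>N\<close> exists whenever the conjugacy classes of \<open>G\<close> are uniformly bounded (B. H. Neumann).
  If \<open>Pr(G) > 2/9\<close>, the elements with small classes generate, in boundedly many steps, a subgroup \<open>F\<close>
  of index at most two: since non-commuting pairs dominate outside \<open>F \<times> F\<close>, index at least three would
  give \<open>Pr(G) \<le> 1/9\<close> up to a small error. If the index is one, all classes are bounded. If it is two,
  \<open>F\<close> must be abelian, since otherwise \<open>Pr(G) \<le> 3/16\<close> up to a small error, and then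
  \<open>Pr(G) = 1/4 + 3/(4 m)\<close> for an integer \<open>m\<close>.
\<close>

section \<open>Commutators and densities of subgroups\<close>

text \<open>The fibres of \<open>f\<close> partition \<open>A\<close>, so the largest one has at
  least average size.\<close>

lemma max_fibre:
  assumes "finite A" "A \<noteq> {}"
  shows "\<exists>b\<in>f ` A. card A \<le> card (f ` A) * card {a \<in> A. f a = b}"
proof -
  define c where "c = (\<lambda>b. card {a \<in> A. f a = b})"
  have fin: "finite (c ` f ` A)" "c ` f ` A \<noteq> {}" using assms by auto
  obtain b where b: "b \<in> f ` A" "c b = Max (c ` f ` A)"
    using Max_in[OF fin] by (metis imageE)
  have le: "c b' \<le> c b" if "b' \<in> f ` A" for b'
    using that fin(1) b(2) by simp
  have "card A = (\<Sum>b\<in>f ` A. c b)"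
    using sum.image_gen[OF assms(1), of "\<lambda>_. 1 :: nat" f] by (simp add: c_def)
  also have "\<dots> \<le> card (f ` A) * c b"
    using sum_bounded_above[of "f ` A" c "c b"] le by simp
  finally show ?thesis using b(1) by (auto simp: c_def)
qed

locale fin_group = group +
  assumes fin [simp]: "finite (carrier G)"
begin

lemma fin_sub [simp]: "A \<subseteq> carrier G \<Longrightarrow> finite A"
  using fin finite_subset by blast

lemma order_pos [simp]: "0 < order G"
  using order_gt_0_iff_finite by simp

lemma inv_mult_cancel [simp]:
  assumes "x \<in> carrier G" "y \<in> carrier G"
  shows "inv x \<otimes> (x \<otimes> y) = y" "x \<otimes> (inv x \<otimes> y) = y"
  using assms by (simp_all flip: m_assoc)

text \<open>For fixed \<open>x\<close> the values \<open>cmt x y\<close> are \<open>x\<close> times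
  the conjugates of \<open>inv x\<close>. The image of \<open>cmt x\<close> therefore has the size
  of the conjugacy class of \<open>x\<close> and stands in for it throughout.\<close>

definition cmt :: "'a \<Rightarrow> 'a \<Rightarrow> 'a"
  where "cmt x y = x \<otimes> y \<otimes> inv x \<otimes> inv y"

definition cent :: "'a \<Rightarrow> 'a set"
  where "cent x = {y \<in> carrier G. x \<otimes> y = y \<otimes> x}"

text \<open>The preimage of the centre of \<open>G / N\<close>.\<close>

definition zmod :: "'a set \<Rightarrow> 'a set"
  where "zmod N = {x \<in> carrier G. \<forall>y\<in>carrier G. cmt x y \<in> N}"

text \<open>For a subgroup \<open>L\<close> this is the normal core, the intersection of all
  conjugates.\<close>

definition core :: "'a set \<Rightarrow> 'a set"
  where "core L = {c \<in> carrier G. \<forall>g\<in>carrier G. g \<otimes> c \<otimes> inv g \<in> L}"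

text \<open>For a subgroup this is the reciprocal of the index. Densities allow subgroups and
  arbitrary sets of elements to be bounded alike, uniformly in the order of the group.\<close>

definition density :: "'a set \<Rightarrow> real"
  where "density A = card A / order G"

lemma cmt_closed [simp]:
  "x \<in> carrier G \<Longrightarrow> y \<in> carrier G \<Longrightarrow> cmt x y \<in> carrier G"
  by (simp add: cmt_def)

lemma cent_sub [simp]: "cent x \<subseteq> carrier G"
  by (auto simp: cent_def)

lemma cmt_mult_left:
  assumes "x \<in> carrier G" "y \<in> carrier G" "z \<in> carrier G"
  shows "cmt (x \<otimes> y) z = x \<otimes> cmt y z \<otimes> inv x \<otimes> cmt x z"
  using assms by (simp add: cmt_def m_assoc inv_mult_group)

lemma cmt_mult_right:
  assumes "x \<in> carrier G" "y \<in> carrier G" "z \<in> carrier G"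
  shows "cmt x (y \<otimes> z) = cmt x y \<otimes> (y \<otimes> cmt x z \<otimes> inv y)"
  using assms by (simp add: cmt_def m_assoc inv_mult_group)

lemma cmt_conj:
  assumes "x \<in> carrier G" "y \<in> carrier G" "g \<in> carrier G"
  shows "g \<otimes> cmt x y \<otimes> inv g = cmt (g \<otimes> x \<otimes> inv g) (g \<otimes> y \<otimes> inv g)"
  using assms by (simp add: cmt_def m_assoc inv_mult_group)

lemma inv_cmt:
  assumes "x \<in> carrier G" "y \<in> carrier G"
  shows "inv (cmt x y) = cmt y x"
  using assms by (simp add: cmt_def m_assoc inv_mult_group)

lemma conj_commuting:
  assumes "x \<in> carrier G" "y \<in> carrier G" "x \<otimes> y = y \<otimes> x"
  shows "x \<otimes> y \<otimes> inv x = y"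
  using assms by (simp add: m_assoc)

lemma cmt_eq_one_iff:
  assumes "x \<in> carrier G" "y \<in> carrier G"
  shows "cmt x y = \<one> \<longleftrightarrow> x \<otimes> y = y \<otimes> x"
proof -
  have "cmt x y = \<one> \<longleftrightarrow> cmt x y \<otimes> (y \<otimes> x) = \<one> \<otimes> (y \<otimes> x)"
    using assms by (intro right_cancel[symmetric]) auto
  thus ?thesis using assms by (simp add: cmt_def m_assoc)
qed

lemma cent_subgroup [simp]:
  assumes "x \<in> carrier G"
  shows "subgroup (cent x) G"
proof (rule subgroupI)
  show "a \<otimes> b \<in> cent x" if "a \<in> cent x" "b \<in> cent x" for a b
  proof -
    have "x \<otimes> (a \<otimes> b) = (a \<otimes> x) \<otimes> b"
      using that assms by (simp add: cent_def flip: m_assoc)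
    also have "\<dots> = a \<otimes> (b \<otimes> x)" using that assms by (simp add: cent_def m_assoc)
    finally show ?thesis using that assms by (simp add: cent_def m_assoc)
  qed
  show "inv a \<in> cent x" if "a \<in> cent x" for a
  proof -
    have a: "a \<in> carrier G" and "inv a \<otimes> (a \<otimes> x) \<otimes> inv a = inv a \<otimes> (x \<otimes> a) \<otimes> inv a"
      using that by (simp_all add: cent_def)
    then have "x \<otimes> inv a = inv a \<otimes> x" using assms by (simp add: m_assoc)
    with a show ?thesis by (simp add: cent_def)
  qed
qed (use assms in \<open>auto simp: cent_def\<close>)

text \<open>Both sides say that \<open>y\<close> and \<open>z\<close> conjugate \<open>inv x\<close>
  to the same element.\<close>

lemma cmt_eq_iff:
  assumes "x \<in> carrier G" "y \<in> carrier G" "z \<in> carrier G"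
  shows "cmt x y = cmt x z \<longleftrightarrow> inv y \<otimes> z \<in> cent x"
proof -
  have "cmt x y = cmt x z \<longleftrightarrow> inv y \<otimes> inv x \<otimes> cmt x y \<otimes> z \<otimes> x = inv y \<otimes> inv x \<otimes> cmt x z \<otimes> z \<otimes> x"
    using assms by simp
  also have "inv y \<otimes> inv x \<otimes> cmt x y \<otimes> z \<otimes> x = inv x \<otimes> (inv y \<otimes> z \<otimes> x)"
    using assms by (simp add: cmt_def m_assoc)
  also have "inv y \<otimes> inv x \<otimes> cmt x z \<otimes> z \<otimes> x = inv x \<otimes> (x \<otimes> (inv y \<otimes> z))"
    using assms by (simp add: cmt_def m_assoc)
  also have "inv x \<otimes> (inv y \<otimes> z \<otimes> x) = inv x \<otimes> (x \<otimes> (inv y \<otimes> z)) \<longleftrightarrow> inv y \<otimes> z \<in> cent x"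
    using assms by (auto simp del: inv_mult_cancel simp: cent_def)
  finally show ?thesis .
qed

text \<open>Multiplication by an element of \<open>H\<close> is an injection of the finite set
  \<open>H\<close> into itself, hence a bijection; this produces the identity and the
  inverses.\<close>

lemma finite_subgroupI:
  assumes "H \<subseteq> carrier G" "H \<noteq> {}"
    and mult: "\<And>a b. a \<in> H \<Longrightarrow> b \<in> H \<Longrightarrow> a \<otimes> b \<in> H"
  shows "subgroup H G"
proof -
  have surj: "(\<otimes>) a ` H = H" if "a \<in> H" for a
    using that assms by (intro endo_inj_surj) (auto simp: inj_on_def subset_iff)
  have one: "\<one> \<in> H"
  proof -
    obtain a where a: "a \<in> H" using assms by blast
    then obtain h where h: "h \<in> H" "a = a \<otimes> h" using surj by blast
    moreover have "a \<in> carrier G" "h \<in> carrier G" using a h assms by auto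
    ultimately show ?thesis using l_cancel_one' by metis
  qed
  show ?thesis
  proof (rule subgroupI)
    fix a assume a: "a \<in> H"
    then obtain h where h: "h \<in> H" "\<one> = a \<otimes> h" using surj one by blast
    then have "h = inv a" using a assms inv_unique' inv_comm by (metis subset_iff)
    then show "inv a \<in> H" using h by simp
  qed (use assms in auto)
qed

text \<open>A pigeonhole form of an index bound: the largest fibre of \<open>f\<close>, translated
  by the inverse of one of its elements, lies in \<open>S\<close>.\<close>

lemma card_le_mult_subgroup:
  assumes "A \<subseteq> carrier G" "finite B" "f ` A \<subseteq> B" "S \<subseteq> carrier G"
    and S: "\<And>x y. x \<in> A \<Longrightarrow> y \<in> A \<Longrightarrow> f x = f y \<Longrightarrow> inv x \<otimes> y \<in> S"
  shows "card A \<le> card B * card S"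
proof (cases "A = {}")
  case False
  then obtain b where b: "b \<in> f ` A" "card A \<le> card (f ` A) * card {a \<in> A. f a = b}"
    using max_fibre[of A f] fin_sub[OF assms(1)] by blast
  obtain x where x: "x \<in> A" "f x = b" using b by blast
  have "card {a \<in> A. f a = b} \<le> card S"
  proof (rule card_inj_on_le)
    show "inj_on (\<lambda>y. inv x \<otimes> y) {a \<in> A. f a = b}"
      using x assms(1) by (auto simp: inj_on_def subset_iff)
    show "(\<lambda>y. inv x \<otimes> y) ` {a \<in> A. f a = b} \<subseteq> S" using S x by auto
  qed (use assms in simp)
  moreover have "card (f ` A) \<le> card B" using assms by (intro card_mono)
  ultimately show ?thesis using b(2) by (meson le_trans mult_le_mono)
qed simp

lemma rcoset_eqD:
  assumes "subgroup H G" "x \<in> carrier G" "y \<in> carrier G" "H #> x = H #> y"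
  shows "x \<otimes> inv y \<in> H"
proof -
  have "x \<in> H #> y" using rcos_self assms by metis
  then obtain h where "h \<in> H" "x = h \<otimes> y" by (auto simp: r_coset_def)
  moreover then have "h \<in> carrier G" using assms subgroup.mem_carrier by fast
  ultimately show ?thesis using assms by (simp add: m_assoc)
qed

section \<open>Densities of subgroups and of their intersections\<close>

lemma density_nonneg [simp]: "0 \<le> density A"
  by (simp add: density_def)

lemma density_mono: "A \<subseteq> B \<Longrightarrow> B \<subseteq> carrier G \<Longrightarrow> density A \<le> density B"
  by (simp add: density_def divide_right_mono card_mono)

lemma density_carrier [simp]: "density (carrier G) = 1"
proof -
  have "card (carrier G) \<noteq> 0" using order_pos by (simp only: order_def)
  then show ?thesis unfolding density_def order_def by simp
qed

lemma density_le_1: "A \<subseteq> carrier G \<Longrightarrow> density A \<le> 1"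
  using density_mono[of A "carrier G"] by simp

lemma card_rcosets:
  assumes "subgroup H G"
  shows "real (card (rcosets H)) = 1 / density H"
proof -
  have "real (card (rcosets H)) * real (card H) = real (order G)"
    using lagrange[OF assms] by (metis of_nat_mult)
  moreover have "card H \<noteq> 0"
    using assms subgroup.one_closed subgroup.subset fin_sub by (metis card_0_eq empty_iff)
  ultimately show ?thesis by (simp add: density_def field_simps)
qed

lemma density_pos: "subgroup H G \<Longrightarrow> 0 < density H"
  using subgroup.one_closed[of H G] subgroup.subset[of H G] fin_sub[of H] order_pos
  by (auto simp: density_def card_gt_0_iff intro!: divide_pos_pos)

text \<open>The index of \<open>A \<inter> B\<close> in \<open>A\<close> is at most that of
  \<open>B\<close> in the group, because \<open>a \<mapsto> B #> inv a\<close> separates the left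
  cosets of \<open>A \<inter> B\<close> in \<open>A\<close>. The inverse turns quotients of right
  cosets into the form \<open>inv x \<otimes> y\<close>.\<close>

lemma density_Int:
  assumes A: "subgroup A G" and B: "subgroup B G"
  shows "density A * density B \<le> density (A \<inter> B)"
proof -
  have sub: "A \<subseteq> carrier G" "B \<subseteq> carrier G" using assms subgroup.subset by auto
  have "card A \<le> card (rcosets B) * card (A \<inter> B)"
  proof (rule card_le_mult_subgroup[where f = "\<lambda>a. B #> inv a"])
    show "finite (rcosets B)" using sub by (simp add: RCOSETS_def)
    show "(\<lambda>a. B #> inv a) ` A \<subseteq> rcosets B" using sub by (auto simp: RCOSETS_def)
    fix x y assume xy: "x \<in> A" "y \<in> A" "B #> inv x = B #> inv y"
    then have "inv x \<otimes> inv (inv y) \<in> B" using sub by (intro rcoset_eqD B) auto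
    moreover have "inv x \<otimes> y \<in> A"
      using xy A by (simp add: subgroup.m_closed subgroup.m_inv_closed)
    ultimately show "inv x \<otimes> y \<in> A \<inter> B" using xy sub by auto
  qed (use sub in auto)
  then have "real (card A) \<le> 1 / density B * card (A \<inter> B)"
    by (metis card_rcosets[OF B] of_nat_le_iff of_nat_mult)
  then have "density A \<le> 1 / density B * density (A \<inter> B)"
    unfolding density_def[of A] density_def[of "A \<inter> B"]
    using divide_right_mono[of _ _ "real (order G)"] by fastforce
  then show ?thesis using density_pos[OF B] by (simp add: field_simps)
qed

text \<open>The separate \<open>A\<close> gives the empty family a value. With
  \<open>\<eta> = 0\<close> the lemma serves to show that an intersection is a subgroup.\<close>

lemma density_INT:
  assumes "finite I" "subgroup A G" "0 \<le> \<eta>"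
    and "\<And>i. i \<in> I \<Longrightarrow> subgroup (B i) G" "\<And>i. i \<in> I \<Longrightarrow> \<eta> \<le> density (B i)"
  shows "subgroup (A \<inter> (\<Inter>i\<in>I. B i)) G \<and> density A * \<eta> ^ card I \<le> density (A \<inter> (\<Inter>i\<in>I. B i))"
  using assms(1,4,5)
proof (induction I)
  case empty
  then show ?case using assms by simp
next
  case (insert i I)
  let ?C = "A \<inter> (\<Inter>i\<in>I. B i)"
  have IH: "subgroup ?C G" "density A * \<eta> ^ card I \<le> density ?C" using insert by auto
  have eq: "A \<inter> (\<Inter>i\<in>insert i I. B i) = ?C \<inter> B i" by auto
  have "density A * \<eta> ^ card (insert i I) = density A * \<eta> ^ card I * \<eta>"
    using insert by simp
  also have "\<dots> \<le> density ?C * density (B i)"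
    using IH insert assms(3) by (intro mult_mono) auto
  also have "\<dots> \<le> density (?C \<inter> B i)" using IH insert by (intro density_Int) auto
  finally show ?case unfolding eq using IH(1) insert.prems(1)[of i] subgroups_Inter_pair by simp
qed

section \<open>Counting commutators through centralisers\<close>

lemma card_cmt_preimage:
  assumes x: "x \<in> carrier G"
  shows "card {y \<in> carrier G. cmt x y \<in> N} = card (N \<inter> cmt x ` carrier G) * card (cent x)"
proof -
  let ?S = "{y \<in> carrier G. cmt x y \<in> N}"
  have im: "cmt x ` ?S = N \<inter> cmt x ` carrier G" by auto
  have "card ?S = (\<Sum>s\<in>cmt x ` ?S. card {y \<in> ?S. cmt x y = s})"
    using sum.image_gen[of ?S "\<lambda>_. 1 :: nat" "cmt x"] by simp
  \<comment> \<open>Each fibre of \<open>cmt x\<close> is a left coset of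
    \<open>cent x\<close>.\<close>
  also have "\<dots> = (\<Sum>s\<in>cmt x ` ?S. card (cent x))"
  proof (rule sum.cong[OF refl])
    fix s assume "s \<in> cmt x ` ?S"
    then obtain y where y: "y \<in> carrier G" "cmt x y = s" "s \<in> N" by auto
    have "{y \<in> ?S. cmt x y = s} = (\<lambda>c. y \<otimes> c) ` cent x"
    proof (intro equalityI subsetI)
      fix z assume z: "z \<in> {y \<in> ?S. cmt x y = s}"
      then have "inv y \<otimes> z \<in> cent x" using cmt_eq_iff[OF x y(1), of z] y by auto
      moreover have "z = y \<otimes> (inv y \<otimes> z)" using y z by simp
      ultimately show "z \<in> (\<lambda>c. y \<otimes> c) ` cent x" by blast
    next
      fix z assume "z \<in> (\<lambda>c. y \<otimes> c) ` cent x"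
      then obtain c where c: "c \<in> cent x" "z = y \<otimes> c" by auto
      then have "c \<in> carrier G" by (simp add: cent_def)
      then show "z \<in> {y \<in> ?S. cmt x y = s}"
        using cmt_eq_iff[OF x y(1), of z] c y by auto
    qed
    moreover have "inj_on (\<lambda>c. y \<otimes> c) (cent x)"
      using y by (auto simp: inj_on_def cent_def)
    ultimately show "card {y \<in> ?S. cmt x y = s} = card (cent x)" by (simp add: card_image)
  qed
  also have "\<dots> = card (N \<inter> cmt x ` carrier G) * card (cent x)" unfolding im by simp
  finally show ?thesis .
qed

text \<open>The orbit-stabiliser theorem for the conjugacy class of \<open>x\<close>.\<close>

lemma order_eq_card_cent:
  assumes "x \<in> carrier G"
  shows "order G = card (cmt x ` carrier G) * card (cent x)"
proof -
  have "{y \<in> carrier G. cmt x y \<in> carrier G} = carrier G"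
    "carrier G \<inter> cmt x ` carrier G = cmt x ` carrier G" using assms by auto
  then show ?thesis using card_cmt_preimage[OF assms, of "carrier G"] by (simp add: order_def)
qed

lemma density_cent:
  assumes "x \<in> carrier G" "cmt x ` carrier G \<subseteq> B" "finite B" "card B \<le> k"
  shows "1 / real k \<le> density (cent x)"
proof -
  have "card (cmt x ` carrier G) \<le> k" 
    using card_mono[OF assms(3,2)] assms(4) by linarith
  then have "order G \<le> k * card (cent x)" using order_eq_card_cent[OF assms(1)] by simp
  then have *: "real (order G) \<le> k * card (cent x)" by (metis of_nat_le_iff of_nat_mult)
  moreover have "0 < k" using calculation order_pos by (cases k) auto
  ultimately show ?thesis using order_pos by (simp add: density_def field_simps)
qed

section \<open>Coset representatives and normal cores\<close>

lemma coset_reps: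
  assumes "subgroup H G"
  shows "\<exists>Y\<subseteq>carrier G. real (card Y) \<le> 1 / density H \<and> (\<forall>g\<in>carrier G. \<exists>y\<in>Y. \<exists>h\<in>H. g = h \<otimes> y)"
proof -
  have H: "H \<subseteq> carrier G" using assms by (rule subgroup.subset)
  define r where "r = (\<lambda>C :: 'a set. SOME y. y \<in> C)"
  have r: "r (H #> g) \<in> H #> g" if "g \<in> carrier G" for g
    unfolding r_def using rcos_self[OF that assms] by (rule someI)
  have fin: "finite (rcosets H)" by (simp add: RCOSETS_def)
  show ?thesis
  proof (intro exI[of _ "r ` (rcosets H)"] conjI ballI)
    show "r ` (rcosets H) \<subseteq> carrier G"
      using r r_coset_subset_G[OF H] by (auto simp: RCOSETS_def)
    show "real (card (r ` (rcosets H))) \<le> 1 / density H"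
      using card_image_le[OF fin] card_rcosets[OF assms] by (metis of_nat_le_iff)
    fix g assume g: "g \<in> carrier G"
    obtain h where h: "h \<in> H" "r (H #> g) = h \<otimes> g" using r[OF g] by (auto simp: r_coset_def)
    then have "g = inv h \<otimes> r (H #> g)" "inv h \<in> H"
      using g H assms subgroup.m_inv_closed by (auto simp: subset_iff)
    then show "\<exists>y\<in>r ` (rcosets H). \<exists>h\<in>H. g = h \<otimes> y"
      using g by (auto simp: RCOSETS_def)
  qed
qed

lemma core_sub: "core L \<subseteq> L"
proof
  fix x assume "x \<in> core L"
  then have "x \<in> carrier G" "\<one> \<otimes> x \<otimes> inv \<one> \<in> L"
    unfolding core_def by blast+
  then show "x \<in> L" by simp
qed

lemma conj_mult:
  assumes "g \<in> carrier G" "a \<in> carrier G" "b \<in> carrier G"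
  shows "g \<otimes> (a \<otimes> b) \<otimes> inv g = (g \<otimes> a \<otimes> inv g) \<otimes> (g \<otimes> b \<otimes> inv g)"
  using assms by (simp add: m_assoc)

lemma conj_conj:
  assumes "g \<in> carrier G" "h \<in> carrier G" "b \<in> carrier G"
  shows "g \<otimes> (h \<otimes> b \<otimes> inv h) \<otimes> inv g = (g \<otimes> h) \<otimes> b \<otimes> inv (g \<otimes> h)"
  using assms by (simp add: m_assoc inv_mult_group)

lemma core_normal:
  assumes "subgroup L G"
  shows "core L \<lhd> G"
proof -
  have "subgroup (core L) G"
    using assms by (intro finite_subgroupI)
      (auto simp: core_def conj_mult subgroup.m_closed subgroup.one_closed intro!: exI[of _ "\<one>"])
  then show ?thesis
    unfolding normal_inv_iff by (auto simp: core_def conj_conj)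
qed

lemma conj_preimage:
  assumes L: "subgroup L G" and y: "y \<in> carrier G"
  shows "subgroup {c \<in> carrier G. y \<otimes> c \<otimes> inv y \<in> L} G"
    "density {c \<in> carrier G. y \<otimes> c \<otimes> inv y \<in> L} = density L"
proof -
  let ?C = "{c \<in> carrier G. y \<otimes> c \<otimes> inv y \<in> L}"
  show "subgroup ?C G"
    using assms by (intro finite_subgroupI)
      (auto simp: conj_mult subgroup.m_closed subgroup.one_closed intro!: exI[of _ "\<one>"])
  have "bij_betw (\<lambda>c. y \<otimes> c \<otimes> inv y) ?C L"
    using y subgroup.subset[OF L]
    by (intro bij_betw_byWitness[where f' = "\<lambda>c. inv y \<otimes> c \<otimes> y"]) (auto simp: m_assoc subset_iff)
  then show "density ?C = density L" by (simp add: density_def bij_betw_same_card)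
qed

text \<open>Whether \<open>g \<otimes> c \<otimes> inv g\<close> lies in \<open>L\<close> depends
  only on the right coset of \<open>L\<close> that contains \<open>g\<close>. So the core is an
  intersection of at most \<open>1 / \<eta>\<close> conjugates of \<open>L\<close>, each as dense as
  \<open>L\<close>.\<close>

lemma density_core:
  assumes L: "subgroup L G" and "0 < \<eta>" "\<eta> \<le> density L"
  shows "\<eta> ^ nat \<lceil>1 / \<eta>\<rceil> \<le> density (core L)"
proof -
  obtain Y where Y: "Y \<subseteq> carrier G" "real (card Y) \<le> 1 / density L"
    "\<forall>g\<in>carrier G. \<exists>y\<in>Y. \<exists>h\<in>L. g = h \<otimes> y"
      using coset_reps[OF L] by blast
  let ?C = "\<lambda>y. {c \<in> carrier G. y \<otimes> c \<otimes> inv y \<in> L}"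
  have sub: "L \<subseteq> carrier G" using L by (rule subgroup.subset)
  have "\<eta> \<le> 1" using assms density_le_1[OF sub] by linarith
  have "1 / density L \<le> 1 / \<eta>" using assms by (simp add: frac_le)
  then have "card Y \<le> nat \<lceil>1 / \<eta>\<rceil>" using Y(2) by linarith
  then have "\<eta> ^ nat \<lceil>1 / \<eta>\<rceil> \<le> \<eta> ^ card Y"
    using \<open>\<eta> \<le> 1\<close> assms by (intro power_decreasing) auto
  also have "\<dots> \<le> density (carrier G \<inter> (\<Inter>y\<in>Y. ?C y))"
    using density_INT[of Y "carrier G" \<eta> ?C] Y conj_preimage[OF L] assms subgroup_self
    by (auto simp: subset_iff)
  also have "\<dots> \<le> density (core L)"
  proof (rule density_mono)
    show "carrier G \<inter> (\<Inter>y\<in>Y. ?C y) \<subseteq> core L"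
    proof (clarsimp simp: core_def)
      fix c g assume c: "c \<in> carrier G" "\<forall>y\<in>Y. y \<otimes> c \<otimes> inv y \<in> L" and g: "g \<in> carrier G"
      obtain y h where yh: "y \<in> Y" "h \<in> L" "g = h \<otimes> y" using Y(3) g by blast
      have "h \<otimes> (y \<otimes> c \<otimes> inv y) \<otimes> inv h \<in> L"
        using yh c L by (simp add: subgroup.m_closed subgroup.m_inv_closed)
      moreover have "h \<in> carrier G" "y \<in> carrier G" using yh Y(1) sub by auto
      ultimately show "g \<otimes> c \<otimes> inv g \<in> L"
        using conj_conj[of h y c] yh(3) c(1) by simp
    qed
  qed (auto simp: core_def)
  finally show ?thesis .
qed

lemma zmod_normal:
  assumes "N \<lhd> G"
  shows "zmod N \<lhd> G"
proof -
  have N: "subgroup N G" "\<And>x h. x \<in> carrier G \<Longrightarrow> h \<in> N \<Longrightarrow> x \<otimes> h \<otimes> inv x \<in> N"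
    using assms unfolding normal_inv_iff by auto
  have "cmt \<one> y \<in> N" if "y \<in> carrier G" for y
    using that N(1) by (simp add: cmt_def subgroup.one_closed)
  then have "subgroup (zmod N) G"
    using N by (intro finite_subgroupI)
      (auto simp: zmod_def cmt_mult_left subgroup.m_closed intro!: exI[of _ "\<one>"])
  moreover have "x \<otimes> h \<otimes> inv x \<in> zmod N"
    if "x \<in> carrier G" "h \<in> zmod N" for x h
  proof -
    have h: "h \<in> carrier G" "\<And>y. y \<in> carrier G \<Longrightarrow> cmt h y \<in> N"
      using that by (auto simp: zmod_def)
    have "cmt (x \<otimes> h \<otimes> inv x) y \<in> N" if y: "y \<in> carrier G" for y
    proof -
      have "y = x \<otimes> (inv x \<otimes> y \<otimes> x) \<otimes> inv x"
        using \<open>x \<in> carrier G\<close> y by (simp add: m_assoc)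
      then have "cmt (x \<otimes> h \<otimes> inv x) y = x \<otimes> cmt h (inv x \<otimes> y \<otimes> x) \<otimes> inv x"
        using cmt_conj[of h "inv x \<otimes> y \<otimes> x" x] \<open>x \<in> carrier G\<close> h y by simp
      then show ?thesis using N(2) h \<open>x \<in> carrier G\<close> y by simp
    qed
    then show ?thesis using that h by (simp add: zmod_def)
  qed
  ultimately show ?thesis unfolding normal_inv_iff by blast
qed

end

section \<open>Commuting modulo a normal subgroup\<close>

text \<open>\<open>P\<close> is a union of right cosets of \<open>Z\<close>. The group is explicit
  because the lemma is applied both to a group and to its direct square.\<close>

lemma card_invariant_dvd:
  fixes G (structure)
  assumes "group G" "finite (carrier G)" "subgroup Z G" "P \<subseteq> carrier G"
    and inv: "\<And>z p. z \<in> Z \<Longrightarrow> p \<in> P \<Longrightarrow> z \<otimes> p \<in> P"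
  shows "card Z dvd card P"
proof -
  interpret group G by fact
  interpret fin_group G by unfold_locales fact
  let ?C = "(\<lambda>p. Z #> p) ` P"
  have Z: "Z \<subseteq> carrier G" using assms subgroup.subset by blast
  have sub: "?C \<subseteq> rcosets Z" using assms(4) by (auto simp: RCOSETS_def)
  have U: "\<Union>?C = P"
  proof
    show "\<Union>?C \<subseteq> P" using inv by (auto simp: r_coset_def)
    show "P \<subseteq> \<Union>?C" using rcos_self[OF _ assms(3)] assms(4) by blast
  qed
  have "card Z * card ?C = card (\<Union>?C)"
  proof (rule card_partition)
    show "finite ?C" "finite (\<Union>?C)" using U assms(4) by simp_all
    show "card c = card Z" if "c \<in> ?C" for c
      using that sub card_rcosets_equal[OF _ Z] by (metis subsetD)
    show "c1 \<inter> c2 = {}" if "c1 \<in> ?C" "c2 \<in> ?C" "c1 \<noteq> c2" for c1 c2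
      using that sub rcos_disjoint[OF assms(3)] by (auto simp: pairwise_def disjnt_def)
  qed
  then show ?thesis using U by (metis dvd_triv_left)
qed

text \<open>With \<open>r\<close> the index of \<open>zmod N\<close>, whether \<open>[x, y] \<in> N\<close> depends only on the cosets of \<open>x\<close> and \<open>y\<close>, so
  that the probability of this event is \<open>k / r\<^sup>2\<close>.\<close>

definition square_fractions :: "real \<Rightarrow> real set"
  where "square_fractions \<eta> =
    (\<lambda>(k, r). real k / (real r)\<^sup>2) ` ({..(nat \<lceil>1 / \<eta>\<rceil>)\<^sup>2} \<times> {..nat \<lceil>1 / \<eta>\<rceil>})"

context fin_group begin

definition prob_cmt_in :: "'a set \<Rightarrow> real"
  where "prob_cmt_in N =
    card {(x, y). x \<in> carrier G \<and> y \<in> carrier G \<and> cmt x y \<in> N} / (real (order G))\<^sup>2"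

definition uncovered :: "'a set \<Rightarrow> 'a set"
  where "uncovered N = {x \<in> carrier G. \<not> N \<subseteq> cmt x ` carrier G}"

lemma prob_cmt_in_sum:
  "prob_cmt_in N = (\<Sum>x\<in>carrier G. real (card (N \<inter> cmt x ` carrier G) * card (cent x))) / (real (order G))\<^sup>2"
proof -
  have eq: "{(x, y). x \<in> carrier G \<and> y \<in> carrier G \<and> cmt x y \<in> N}
    = (SIGMA x:carrier G. {y \<in> carrier G. cmt x y \<in> N})" by auto
  have "card (SIGMA x:carrier G. {y \<in> carrier G. cmt x y \<in> N})
    = (\<Sum>x\<in>carrier G. card {y \<in> carrier G. cmt x y \<in> N})"
    by (rule card_SigmaI) auto
  then show ?thesis unfolding prob_cmt_in_def eq by (simp add: card_cmt_preimage)
qed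

lemma commuting_prob_sum:
  "commuting_prob G = (\<Sum>x\<in>carrier G. real (card (cent x))) / (real (order G))\<^sup>2"
proof -
  have eq: "{(x, y). x \<in> carrier G \<and> y \<in> carrier G \<and> x \<otimes> y = y \<otimes> x}
    = (SIGMA x:carrier G. cent x)" by (auto simp: cent_def)
  have "card (SIGMA x:carrier G. cent x) = (\<Sum>x\<in>carrier G. card (cent x))"
    by (rule card_SigmaI) auto
  then show ?thesis unfolding commuting_prob_def eq by simp
qed

text \<open>All nonempty fibres of \<open>cmt x\<close> have the size of \<open>cent x\<close>, and
  at most \<open>card N\<close> of them lie over \<open>N\<close>.\<close>

lemma prob_cmt_in_le:
  assumes "finite N"
  shows "prob_cmt_in N \<le> card N * commuting_prob G"
proof -
  have "(\<Sum>x\<in>carrier G. real (card (N \<inter> cmt x ` carrier G) * card (cent x)))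
    \<le> (\<Sum>x\<in>carrier G. real (card N * card (cent x)))"
    using assms by (intro sum_mono of_nat_mono mult_le_mono card_mono) auto
  also have "\<dots> = card N * (\<Sum>x\<in>carrier G. real (card (cent x)))"
    by (simp add: sum_distrib_left)
  finally show ?thesis
    unfolding prob_cmt_in_sum commuting_prob_sum by (simp add: divide_right_mono)
qed

text \<open>The converse estimate: when the commutators of \<open>x\<close> cover \<open>N\<close>,
  exactly \<open>card N\<close> fibres of \<open>cmt x\<close> lie over \<open>N\<close>. The other
  \<open>x\<close> are charged with their whole density.\<close>

lemma commuting_prob_le:
  assumes "finite N" "N \<noteq> {}"
  shows "commuting_prob G \<le> prob_cmt_in N / card N + density (uncovered N)"
proof -
  let ?B = "uncovered N" and ?n = "real (card N)" and ?o = "real (order G)"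
  have n: "?n > 0" using assms by (simp add: card_gt_0_iff)
  have B: "?B \<subseteq> carrier G" by (auto simp: uncovered_def)
  have "?n * (\<Sum>x\<in>carrier G. real (card (cent x))) = (\<Sum>x\<in>carrier G. ?n * card (cent x))"
    by (simp add: sum_distrib_left)
  also have "\<dots> \<le> (\<Sum>x\<in>carrier G. real (card (N \<inter> cmt x ` carrier G) * card (cent x))
    + (if x \<in> ?B then ?n * ?o else 0))"
  proof (rule sum_mono)
    fix x assume x: "x \<in> carrier G"
    show "?n * card (cent x) \<le> real (card (N \<inter> cmt x ` carrier G) * card (cent x))
      + (if x \<in> ?B then ?n * ?o else 0)"
    proof (cases "x \<in> ?B")
      case True
      have "card (cent x) \<le> order G" by (simp add: order_def card_mono)
      then have "?n * card (cent x) \<le> ?n * ?o" by (simp add: mult_left_mono)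
      then show ?thesis using True by (simp add: add_increasing)
    next
      case False
      then have "N \<inter> cmt x ` carrier G = N" using x by (auto simp: uncovered_def)
      then show ?thesis using False by simp
    qed
  qed
  also have "\<dots> = prob_cmt_in N * ?o\<^sup>2 + card ?B * (?n * ?o)"
    using B by (simp add: prob_cmt_in_sum sum.distrib sum.If_cases Int_absorb1)
  finally have "(\<Sum>x\<in>carrier G. real (card (cent x))) / ?o\<^sup>2
    \<le> (prob_cmt_in N * ?o\<^sup>2 + card ?B * (?n * ?o)) / (?n * ?o\<^sup>2)"
    using n by (simp add: field_simps)
  also have "\<dots> = prob_cmt_in N / ?n + card ?B / ?o"
    using n order_pos by (simp add: field_simps power2_eq_square)
  finally show ?thesis by (simp add: commuting_prob_sum density_def)
qed

lemma prob_cmt_in_square_fraction: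
  assumes N: "N \<lhd> G" and "0 < \<eta>" "\<eta> \<le> density (zmod N)"
  shows "prob_cmt_in N \<in> square_fractions \<eta>"
proof -
  let ?Z = "zmod N" and ?P = "{(x, y). x \<in> carrier G \<and> y \<in> carrier G \<and> cmt x y \<in> N}"
  have Ns: "subgroup N G" "\<And>x h. x \<in> carrier G \<Longrightarrow> h \<in> N \<Longrightarrow> x \<otimes> h \<otimes> inv x \<in> N"
    using N unfolding normal_inv_iff by auto
  have Z: "subgroup ?Z G" using zmod_normal[OF N] normal_imp_subgroup by blast
  have Zc: "z \<in> carrier G" "y \<in> carrier G \<Longrightarrow> cmt z y \<in> N" "y \<in> carrier G \<Longrightarrow> cmt y z \<in> N"
    if "z \<in> ?Z" for z y
    using that inv_cmt[of z y] subgroup.m_inv_closed[OF Ns(1), of "cmt z y"] by (auto simp: zmod_def)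
  have grp: "group (G \<times>\<times> G)" by (rule DirProd_group) unfold_locales
  \<comment> \<open>Left multiplication of either coordinate by an element of \<open>zmod N\<close>
    keeps the commutator in \<open>N\<close>, so the pairs fill whole cosets of the square of
    \<open>zmod N\<close>.\<close>
  have "card (?Z \<times> ?Z) dvd card ?P"
  proof (rule card_invariant_dvd[OF grp])
    show "finite (carrier (G \<times>\<times> G))" by (simp add: DirProd_def)
    show "subgroup (?Z \<times> ?Z) (G \<times>\<times> G)"
      by (rule DirProd_subgroups[OF is_group Z is_group Z])
    show "?P \<subseteq> carrier (G \<times>\<times> G)" by (auto simp: DirProd_def)
    fix z p assume "z \<in> ?Z \<times> ?Z" "p \<in> ?P"
    then obtain a b x y where eq: "z = (a, b)" "p = (x, y)" and ab: "a \<in> ?Z" "b \<in> ?Z"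
      and xy: "x \<in> carrier G" "y \<in> carrier G" "cmt x y \<in> N" by auto
    note c = Zc(1)[OF ab(1)] Zc(1)[OF ab(2)]
    have "cmt x (b \<otimes> y) \<in> N"
      using c xy Zc[OF ab(2)] Ns by (simp add: cmt_mult_right subgroup.m_closed)
    then have "cmt (a \<otimes> x) (b \<otimes> y) \<in> N"
      using c xy Zc[OF ab(1)] Ns by (simp add: cmt_mult_left subgroup.m_closed)
    then show "z \<otimes>\<^bsub>G \<times>\<times> G\<^esub> p \<in> ?P"
      using c xy eq by (simp add: DirProd_def)
  qed
  then obtain k where k: "card ?P = (card ?Z)\<^sup>2 * k"
    by (auto simp: card_cartesian_product power2_eq_square)
  let ?r = "card (rcosets ?Z)" and ?m = "nat \<lceil>1 / \<eta>\<rceil>"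
  have r: "order G = ?r * card ?Z" using lagrange[OF Z] by simp
  have pos: "card ?Z > 0" "?r > 0" using r order_pos by (metis gr0I mult_is_0 less_irrefl)+
  have "real ?r \<le> 1 / \<eta>" using card_rcosets[OF Z] assms by (simp add: frac_le)
  then have rm: "?r \<le> ?m" by linarith
  have "card ?P \<le> card (carrier G \<times> carrier G)" by (intro card_mono) auto
  then have "(card ?Z)\<^sup>2 * k \<le> (?r * card ?Z)\<^sup>2"
    using k r by (simp add: card_cartesian_product order_def power2_eq_square)
  then have "k \<le> ?r\<^sup>2" using pos by (simp add: power_mult_distrib)
  then have "k \<le> ?m\<^sup>2" using rm by (meson le_trans power_mono zero_le)
  moreover have "prob_cmt_in N = real k / (real ?r)\<^sup>2"
    using pos unfolding prob_cmt_in_def k r by (simp add: power_mult_distrib)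
  ultimately show ?thesis using rm unfolding square_fractions_def by force
qed

end

section \<open>Descent to a smaller normal subgroup\<close>

text \<open>Here \<open>h\<close> bounds the density of \<open>zcent N\<close> and \<open>k\<close>
  that of the subgroup found in \<open>uncovered_fibre\<close>. The first factor is the cost of
  passing to the core of that subgroup; the second, of intersecting with at most
  \<open>nat \<lceil>1 / h\<rceil>\<close> subgroups of density at least
  \<open>h / m\<close>.\<close>

definition descent_density :: "nat \<Rightarrow> real \<Rightarrow> real \<Rightarrow> real"
  where "descent_density m \<eta> \<delta> =
    (let h = \<eta> * (1 / m) ^ m; k = \<delta> * h / 2 ^ m
     in k ^ nat \<lceil>1 / k\<rceil> * (h / m) ^ nat \<lceil>1 / h\<rceil>)"

lemma descent_density_pos:
  "0 < m \<Longrightarrow> 0 < \<eta> \<Longrightarrow> 0 < \<delta> \<Longrightarrow> 0 < descent_density m \<eta> \<delta>"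
  by (simp add: descent_density_def Let_def)

context fin_group begin

text \<open>Centralising \<open>N\<close>, besides being central modulo \<open>N\<close>, makes
  commutators multiplicative: the conjugations in \<open>cmt_mult_left\<close> and
  \<open>cmt_mult_right\<close> then act trivially on values in \<open>N\<close>.\<close>

definition zcent :: "'a set \<Rightarrow> 'a set"
  where "zcent N = zmod N \<inter> (\<Inter>n\<in>N. cent n)"

lemma zcentD:
  assumes "c \<in> zcent N"
  shows "c \<in> carrier G" "y \<in> carrier G \<Longrightarrow> cmt c y \<in> N" "n \<in> N \<Longrightarrow> c \<otimes> n = n \<otimes> c"
  using assms by (auto simp: zcent_def zmod_def cent_def)

text \<open>By normality the commutators of any \<open>n \<in> N\<close> lie in \<open>N\<close>, so
  its centraliser has index at most \<open>m\<close>; at most \<open>m\<close> such centralisers are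
  intersected.\<close>

lemma zcent_density:
  assumes N: "N \<lhd> G" and "card N \<le> m" "0 \<le> \<eta>" "\<eta> \<le> density (zmod N)"
  shows "subgroup (zcent N) G" "\<eta> * (1 / m) ^ m \<le> density (zcent N)"
proof -
  have Ns: "subgroup N G" "\<And>x h. x \<in> carrier G \<Longrightarrow> h \<in> N \<Longrightarrow> x \<otimes> h \<otimes> inv x \<in> N"
    using N unfolding normal_inv_iff by auto
  have sub: "N \<subseteq> carrier G" using Ns(1) by (rule subgroup.subset)
  have c: "1 / real m \<le> density (cent n)" if n: "n \<in> N" for n
  proof (rule density_cent)
    show "cmt n ` carrier G \<subseteq> N"
    proof clarify
      fix y assume y: "y \<in> carrier G"
      have "n \<otimes> (y \<otimes> inv n \<otimes> inv y) \<in> N"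
        using Ns n y by (simp add: subgroup.m_closed subgroup.m_inv_closed)
      moreover have "n \<in> carrier G" using n sub by blast
      ultimately show "cmt n y \<in> N" using y by (simp add: cmt_def m_assoc)
    qed
  qed (use n sub assms in auto)
  have "subgroup (zmod N) G" using zmod_normal[OF N] normal_imp_subgroup by blast
  then have *: "subgroup (zcent N) G \<and> density (zmod N) * (1 / m) ^ card N \<le> density (zcent N)"
    unfolding zcent_def using sub c by (intro density_INT) (auto simp: subset_iff)
  then show "subgroup (zcent N) G" by blast
  have "card N > 0" using sub subgroup.one_closed[OF Ns(1)] by (auto simp: card_gt_0_iff)
  then have "(1 / real m) ^ m \<le> (1 / m) ^ card N" using assms by (intro power_decreasing) auto
  then have "\<eta> * (1 / m) ^ m \<le> density (zmod N) * (1 / m) ^ card N"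
    using assms by (intro mult_mono) auto
  then show "\<eta> * (1 / m) ^ m \<le> density (zcent N)" using * by linarith
qed

lemma zcent_conj:
  assumes N: "N \<lhd> G" and c: "c \<in> zcent N" and g: "g \<in> carrier G"
  shows "g \<otimes> c \<otimes> inv g \<in> zcent N"
proof -
  have Ns: "subgroup N G" "\<And>x h. x \<in> carrier G \<Longrightarrow> h \<in> N \<Longrightarrow> x \<otimes> h \<otimes> inv x \<in> N"
    using N unfolding normal_inv_iff by auto
  have "g \<otimes> c \<otimes> inv g \<in> zmod N"
    using zmod_normal[OF N] c g unfolding normal_inv_iff zcent_def by auto
  moreover have "g \<otimes> c \<otimes> inv g \<in> cent n" if n: "n \<in> N" for n
  proof -
    have nG: "n \<in> carrier G" using n subgroup.subset[OF Ns(1)] by blast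
    have "inv g \<otimes> n \<otimes> inv (inv g) \<in> N" using Ns(2)[OF inv_closed[OF g] n] .
    then have "c \<otimes> (inv g \<otimes> n \<otimes> g) = inv g \<otimes> n \<otimes> g \<otimes> c"
      using zcentD[OF c] g by simp
    then have "g \<otimes> (c \<otimes> (inv g \<otimes> n \<otimes> g)) \<otimes> inv g = g \<otimes> (inv g \<otimes> n \<otimes> g \<otimes> c) \<otimes> inv g"
      by simp
    then show ?thesis using g nG zcentD(1)[OF c] by (simp add: cent_def m_assoc)
  qed
  ultimately show ?thesis by (auto simp: zcent_def)
qed

lemma cmt_zcent_mult_right:
  assumes N: "N \<lhd> G" and "x \<in> carrier G" "c \<in> zcent N" "d \<in> zcent N"
  shows "cmt x (c \<otimes> d) = cmt x c \<otimes> cmt x d"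
proof -
  have "subgroup N G" using N normal_imp_subgroup by blast
  then have "cmt x d \<in> N"
    using zcentD[OF assms(4)] assms(2) inv_cmt[of d x] subgroup.m_inv_closed by metis
  then have "c \<otimes> cmt x d \<otimes> inv c = cmt x d"
    using zcentD[OF assms(3)] zcentD[OF assms(4)] assms(2) by (intro conj_commuting) auto
  then show ?thesis using assms zcentD(1) by (simp add: cmt_mult_right)
qed

lemma cmt_zcent_mult_left:
  assumes N: "N \<lhd> G" and "x \<in> carrier G" "c \<in> zcent N" "d \<in> zcent N"
  shows "cmt (c \<otimes> x) d = cmt x d \<otimes> cmt c d"
proof -
  have "subgroup N G" using N normal_imp_subgroup by blast
  then have "cmt x d \<in> N"
    using zcentD[OF assms(4)] assms(2) inv_cmt[of d x] subgroup.m_inv_closed by metis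
  then have "c \<otimes> cmt x d \<otimes> inv c = cmt x d"
    using zcentD[OF assms(3)] zcentD[OF assms(4)] assms(2) by (intro conj_commuting) auto
  then show ?thesis using assms zcentD(1) by (simp add: cmt_mult_left)
qed

text \<open>For \<open>d\<close> in \<open>zcent N\<close> the map \<open>d \<mapsto> [x, d]\<close> is a homomorphism into \<open>N\<close>, and its image is a proper
  subgroup when \<open>x\<close> is uncovered. By pigeonhole many uncovered \<open>x\<close> in one coset of \<open>zcent N\<close> share the
  same image \<open>S\<close>, and the quotients of these \<open>x\<close> satisfy \<open>[c, zcent N] \<subseteq> S\<close>.\<close>

lemma uncovered_fibre:
  assumes N: "N \<lhd> G" and "card N \<le> m" "0 \<le> \<eta>" "\<eta> \<le> density (zmod N)"
    and "0 < \<delta>" "\<delta> \<le> density (uncovered N)"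
  shows "\<exists>S. subgroup S G \<and> S \<subset> N \<and> subgroup {c \<in> zcent N. \<forall>d\<in>zcent N. cmt c d \<in> S} G \<and>
    \<delta> * (\<eta> * (1 / m) ^ m) / 2 ^ m \<le> density {c \<in> zcent N. \<forall>d\<in>zcent N. cmt c d \<in> S}"
proof -
  let ?H = "zcent N" and ?B = "uncovered N" and ?h = "\<eta> * (1 / m) ^ m"
  note Hd = zcent_density[OF assms(1-4)]
  have Ns: "subgroup N G" using N normal_imp_subgroup by blast
  have Nc: "N \<subseteq> carrier G" using Ns by (rule subgroup.subset)
  have BG: "?B \<subseteq> carrier G" by (auto simp: uncovered_def)
  have "?B \<noteq> {}" using assms(5,6) by (auto simp: density_def)
  define I where "I = (\<lambda>x. cmt x ` ?H)"
  have IN: "I x \<subseteq> N" if "x \<in> carrier G" for x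
  proof
    fix s assume "s \<in> I x"
    then obtain d where d: "d \<in> ?H" "s = cmt x d" by (auto simp: I_def)
    then show "s \<in> N"
      using zcentD[OF d(1)] that inv_cmt[of d x] subgroup.m_inv_closed[OF Ns] by metis
  qed
  have Isub: "subgroup (I x) G" if x: "x \<in> carrier G" for x
  proof (rule finite_subgroupI)
    show "I x \<subseteq> carrier G" using IN[OF x] Nc by blast
    show "I x \<noteq> {}" using subgroup.one_closed[OF Hd(1)] by (auto simp: I_def)
    show "a \<otimes> b \<in> I x" if "a \<in> I x" "b \<in> I x" for a b
    proof -
      obtain c where c: "c \<in> ?H" "a = cmt x c"
        using \<open>a \<in> I x\<close> unfolding I_def by blast
      obtain d where d: "d \<in> ?H" "b = cmt x d"
        using \<open>b \<in> I x\<close> unfolding I_def by blast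
      have "a \<otimes> b = cmt x (c \<otimes> d)" using cmt_zcent_mult_right[OF N x] c d by simp
      moreover have "c \<otimes> d \<in> ?H" using subgroup.m_closed[OF Hd(1)] c d by simp
      ultimately show ?thesis unfolding I_def by blast
    qed
  qed
  let ?f = "\<lambda>x. (?H #> x, I x)"
  obtain b where b: "b \<in> ?f ` ?B" "card ?B \<le> card (?f ` ?B) * card {x \<in> ?B. ?f x = b}"
    using max_fibre[OF fin_sub[OF BG] \<open>?B \<noteq> {}\<close>, of ?f] by blast
  then obtain x0 where x0: "x0 \<in> ?B" "b = ?f x0" by auto
  then have x0G: "x0 \<in> carrier G" using BG by blast
  define S where "S = I x0"
  define L where "L = {c \<in> ?H. \<forall>d\<in>?H. cmt c d \<in> S}"
  have S: "subgroup S G" using Isub x0G by (simp add: S_def)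
  have "S \<noteq> N"
  proof
    assume "S = N"
    moreover have "S \<subseteq> cmt x0 ` carrier G"
      using zcentD(1)[of _ N] unfolding S_def I_def by blast
    ultimately show False using x0(1) by (simp add: uncovered_def)
  qed
  with IN[OF x0G] have SN: "S \<subset> N" by (auto simp: S_def)
  have L: "subgroup L G"
  proof (rule finite_subgroupI)
    show "L \<subseteq> carrier G" using zcentD(1) by (auto simp: L_def)
    have "\<one> \<in> L"
      using subgroup.one_closed[OF Hd(1)] subgroup.one_closed[OF S] zcentD(1)[of _ N]
      by (auto simp: L_def cmt_def)
    then show "L \<noteq> {}" by blast
    fix a c assume "a \<in> L" "c \<in> L"
    then show "a \<otimes> c \<in> L"
      using cmt_zcent_mult_left[OF N _ _ ] zcentD(1)[of _ N] subgroup.m_closed[OF Hd(1)] subgroup.m_closed[OF S]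
      by (auto simp: L_def)
  qed
  have "card {x \<in> ?B. ?f x = b} \<le> card L"
  proof (rule card_inj_on_le)
    show "inj_on (\<lambda>x. x \<otimes> inv x0) {x \<in> ?B. ?f x = b}"
      using BG x0G by (auto simp: inj_on_def subset_iff)
    show "(\<lambda>x. x \<otimes> inv x0) ` {x \<in> ?B. ?f x = b} \<subseteq> L"
    proof (rule image_subsetI)
      fix x assume "x \<in> {x \<in> ?B. ?f x = b}"
      then have x: "x \<in> ?B" "?f x = b" by auto
      then have xG: "x \<in> carrier G" using BG by blast
      let ?c = "x \<otimes> inv x0"
      have c: "?c \<in> ?H" using rcoset_eqD[OF Hd(1) xG x0G] x x0 by simp
      have "cmt ?c d \<in> S" if d: "d \<in> ?H" for d
      proof -
        have dG: "d \<in> carrier G" using zcentD(1)[OF d] .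
        have "cmt x d = cmt x0 d \<otimes> cmt ?c d"
          using cmt_zcent_mult_left[OF N x0G c d] xG x0G by (simp add: m_assoc)
        then have "cmt ?c d = inv (cmt x0 d) \<otimes> cmt x d"
          using xG x0G dG by simp
        moreover have "cmt x0 d \<in> S" "cmt x d \<in> S"
          using d x x0 by (auto simp: S_def I_def)
        ultimately show ?thesis using S by (simp add: subgroup.m_closed subgroup.m_inv_closed)
      qed
      then show "?c \<in> L" using c by (simp add: L_def)
    qed
    show "finite L" using fin_sub[OF subgroup.subset[OF L]] .
  qed
  \<comment> \<open>The images are subsets of \<open>N\<close>, hence the factor
    \<open>2 ^ m\<close>.\<close>
  moreover have "card (?f ` ?B) \<le> card (rcosets ?H) * 2 ^ m"
  proof -
    have fR: "finite (rcosets ?H)" by (simp add: RCOSETS_def)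
    have "card (?f ` ?B) \<le> card ((rcosets ?H) \<times> Pow N)"
      using BG IN fR Nc by (intro card_mono) (auto simp: RCOSETS_def)
    also have "\<dots> = card (rcosets ?H) * 2 ^ card N"
      using Nc by (simp add: card_cartesian_product card_Pow)
    also have "\<dots> \<le> card (rcosets ?H) * 2 ^ m" using assms(2) by simp
    finally show ?thesis .
  qed
  ultimately have "card (?f ` ?B) * card {x \<in> ?B. ?f x = b} \<le> card (rcosets ?H) * 2 ^ m * card L"
    by (intro mult_le_mono)
  then have "card ?B \<le> card (rcosets ?H) * 2 ^ m * card L" by (rule le_trans[OF b(2)])
  then have "real (card ?B) \<le> real (card (rcosets ?H) * 2 ^ m * card L)"
    by (simp only: of_nat_le_iff)
  then have "real (card ?B) \<le> real (card (rcosets ?H)) * 2 ^ m * real (card L)"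
    by simp
  then have "real (card ?B) / order G \<le> 1 / density ?H * 2 ^ m * real (card L) / order G"
    unfolding card_rcosets[OF Hd(1)] by (rule divide_right_mono) simp
  then have "\<delta> \<le> 1 / density ?H * 2 ^ m * density L"
    using assms(6) by (simp add: density_def)
  then have "\<delta> * density ?H / 2 ^ m \<le> density L"
    using density_pos[OF Hd(1)] by (simp add: field_simps)
  moreover have "\<delta> * ?h / 2 ^ m \<le> \<delta> * density ?H / 2 ^ m"
    using Hd(2) assms(5) by (intro divide_right_mono mult_left_mono) auto
  ultimately have "\<delta> * ?h / 2 ^ m \<le> density L" by linarith
  then show ?thesis using S SN L unfolding L_def by blast
qed

text \<open>The new subgroup is \<open>core S\<close>, with \<open>S\<close> the proper subgroup of
  \<open>N\<close> from \<open>uncovered_fibre\<close>. Taking the core of \<open>L\<close> puts the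
  commutators with \<open>zcent N\<close> into every conjugate of \<open>S\<close>; centralising
  coset representatives of \<open>zcent N\<close> extends this to commutators with the whole
  group.\<close>

lemma descent:
  assumes N: "N \<lhd> G" and m: "card N \<le> m" and \<eta>: "0 < \<eta>" "\<eta> \<le> density (zmod N)"
    and \<delta>: "0 < \<delta>" "\<delta> \<le> density (uncovered N)"
  shows "\<exists>N'. N' \<lhd> G \<and> N' \<subset> N \<and> descent_density m \<eta> \<delta> \<le> density (zmod N')"
proof -
  define H where "H = zcent N"
  define h where "h = \<eta> * (1 / m) ^ m"
  define k where "k = \<delta> * h / 2 ^ m"
  have Ns: "subgroup N G" using N normal_imp_subgroup by blast
  have Nc: "N \<subseteq> carrier G" using Ns by (rule subgroup.subset)
  have "card N > 0" using Nc subgroup.one_closed[OF Ns] by (auto simp: card_gt_0_iff)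
  then have mpos: "0 < m" using m by simp
  have hk: "0 < h" "0 < k" using mpos \<eta> \<delta> by (simp_all add: h_def k_def)
  have H: "subgroup H G" "h \<le> density H"
    using zcent_density[OF N m _ \<eta>(2)] \<eta>(1) by (simp_all add: H_def h_def)
  have HG: "H \<subseteq> carrier G" using H(1) by (rule subgroup.subset)
  obtain S where S: "subgroup S G" "S \<subset> N" and
    L: "subgroup {c \<in> H. \<forall>d\<in>H. cmt c d \<in> S} G" "k \<le> density {c \<in> H. \<forall>d\<in>H. cmt c d \<in> S}"
    using uncovered_fibre[OF N m _ \<eta>(2) \<delta>] \<eta>(1) unfolding H_def h_def k_def by auto
  define L where "L = {c \<in> H. \<forall>d\<in>H. cmt c d \<in> S}"
  have C: "subgroup (core L) G" "k ^ nat \<lceil>1 / k\<rceil> \<le> density (core L)"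
    using core_normal[OF L(1)] density_core[OF L(1) hk(2) L(2)] normal_imp_subgroup
    by (auto simp: L_def)
  obtain Y where Y: "Y \<subseteq> carrier G" "real (card Y) \<le> 1 / density H"
    "\<forall>g\<in>carrier G. \<exists>y\<in>Y. \<exists>h\<in>H. g = h \<otimes> y"
      using coset_reps[OF H(1)] by blast
  have "1 / density H \<le> 1 / h" using H(2) hk by (simp add: frac_le)
  then have cY: "card Y \<le> nat \<lceil>1 / h\<rceil>" using Y(2) by linarith
  have hm: "h / m \<le> 1"
  proof -
    have "h \<le> 1" using H(2) density_le_1[OF HG] by linarith
    then show ?thesis using mpos by simp
  qed
  \<comment> \<open>Modulo \<open>core S\<close>, elements of \<open>core L\<close> commute with \<open>H\<close>, and elements of \<open>J\<close> also with the coset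
    representatives of \<open>H\<close>.\<close>
  define J where "J = core L \<inter> (\<Inter>y\<in>Y. H \<inter> cent y)"
  \<comment> \<open>The commutators of \<open>y\<close> with \<open>H\<close> lie in
    \<open>N\<close>, so they take at most \<open>card N\<close> values, and elements of
    \<open>H\<close> with equal value differ by an element of \<open>cent y\<close>.\<close>
  have dc: "h / m \<le> density (H \<inter> cent y)" if y: "y \<in> carrier G" for y
  proof -
    have "card H \<le> card N * card (H \<inter> cent y)"
    proof (rule card_le_mult_subgroup[where f = "cmt y"])
      show "cmt y ` H \<subseteq> N"
      proof clarify
        fix d assume "d \<in> H"
        then show "cmt y d \<in> N"
          using zcentD[of d N] y inv_cmt[of d y] subgroup.m_inv_closed[OF Ns] unfolding H_def by metis
      qed
      fix a b assume ab: "a \<in> H" "b \<in> H" "cmt y a = cmt y b"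
      then have "inv a \<otimes> b \<in> cent y" using cmt_eq_iff[OF y] HG by auto
      then show "inv a \<otimes> b \<in> H \<inter> cent y"
        using ab H(1) by (simp add: subgroup.m_closed subgroup.m_inv_closed)
    qed (use HG Nc in auto)
    also have "\<dots> \<le> m * card (H \<inter> cent y)" using m by simp
    finally have "real (card H) \<le> real m * real (card (H \<inter> cent y))"
      by (metis of_nat_le_iff of_nat_mult)
    then have "real (card H) / order G \<le> real m * real (card (H \<inter> cent y)) / order G"
      by (rule divide_right_mono) simp
    then have "h \<le> m * density (H \<inter> cent y)" using H(2) by (simp add: density_def)
    then show ?thesis using mpos by (simp add: field_simps)
  qed
  have "k ^ nat \<lceil>1 / k\<rceil> * (h / m) ^ nat \<lceil>1 / h\<rceil> \<le> density (core L) * (h / m) ^ card Y"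
    using C hk mpos hm cY by (intro mult_mono power_decreasing) auto
  also have "\<dots> \<le> density J"
  proof -
    have YG: "y \<in> carrier G" if "y \<in> Y" for y using that Y(1) by blast
    have "subgroup (H \<inter> cent y) G" if "y \<in> Y" for y
      using YG[OF that] H(1) subgroups_Inter_pair by simp
    then show ?thesis
      unfolding J_def using dc YG C(1) hk mpos fin_sub[OF Y(1)]
      by (intro conjunct2[OF density_INT]) auto
  qed
  also have "\<dots> \<le> density (zmod (core S))"
  proof (rule density_mono)
    show "J \<subseteq> zmod (core S)"
    proof
      fix c assume c: "c \<in> J"
      have cL: "\<And>g. g \<in> carrier G \<Longrightarrow> g \<otimes> c \<otimes> inv g \<in> L" and cG: "c \<in> carrier G"
        using c by (auto simp: J_def core_def)
      have "cmt c g \<in> core S" if g: "g \<in> carrier G" for g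
      proof -
        obtain y e where y: "y \<in> Y" and e: "e \<in> H" and g_eq: "g = e \<otimes> y"
          using Y(3) g by blast
        have eG: "e \<in> carrier G" and yG: "y \<in> carrier G" using e y HG Y(1) by auto
        have "c \<in> cent y" using c y unfolding J_def by blast
        then have "cmt c y = \<one>" using cG yG by (simp add: cmt_eq_one_iff cent_def)
        then have "cmt c g = cmt c e" using cG eG yG by (simp add: g_eq cmt_mult_right)
        \<comment> \<open>A conjugate of this commutator is again a commutator of an element of
          \<open>L\<close> with one of \<open>H\<close>, as \<open>c\<close> is in the core of
          \<open>L\<close> and \<open>H\<close> is invariant.\<close>
        moreover have "q \<otimes> cmt c e \<otimes> inv q \<in> S" if q: "q \<in> carrier G" for q
        proof -
          have "q \<otimes> e \<otimes> inv q \<in> H" using zcent_conj[OF N] e q by (simp add: H_def)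
          then show ?thesis using cL[OF q] cmt_conj[OF cG eG q] by (simp add: L_def)
        qed
        ultimately show ?thesis using cG eG by (simp add: core_def)
      qed
      then show "c \<in> zmod (core S)" using cG by (simp add: zmod_def)
    qed
  qed (auto simp: zmod_def)
  finally have "descent_density m \<eta> \<delta> \<le> density (zmod (core S))"
    by (simp add: descent_density_def Let_def h_def k_def)
  moreover have "core S \<subset> N" using core_sub[of S] S(2) by blast
  ultimately show ?thesis using core_normal[OF S(1)] by blast
qed

text \<open>The cases are whether the uncovered set has density below \<open>\<delta>\<close>. With
  order \<open>Suc m\<close>, any proper subgroup has order at most \<open>m\<close>, the form that
  the induction on the order of \<open>N\<close> consumes.\<close>

lemma commuting_prob_dichotomy:
  assumes N: "N \<lhd> G" and m: "card N = Suc m" and \<eta>: "0 < \<eta>" "\<eta> \<le> density (zmod N)" and "0 < \<delta>"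
  shows "commuting_prob G \<le> prob_cmt_in N / Suc m + \<delta> \<or>
    (\<exists>N'. N' \<lhd> G \<and> card N' \<le> m \<and> descent_density (Suc m) \<eta> \<delta> \<le> density (zmod N'))"
proof (cases "\<delta> \<le> density (uncovered N)")
  case True
  then obtain N' where N': "N' \<lhd> G" "N' \<subset> N" "descent_density (Suc m) \<eta> \<delta> \<le> density (zmod N')"
    using descent[OF N _ \<eta> assms(5)] m by auto
  have "finite N" using m card_ge_0_finite[of N] by simp
  then have "card N' < card N" using N'(2) by (intro psubset_card_mono)
  then show ?thesis using N' m by auto
next
  case False
  have "finite N" "N \<noteq> {}" using m card_ge_0_finite[of N] by auto
  then show ?thesis using commuting_prob_le[of N] m False by auto
qed

end

section \<open>Sets whose limits are rational and approached from above\<close>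

text \<open>The second conclusion excludes convergence to \<open>l\<close> strictly from below.
  Being existential, it carries over from a subsequence to the whole sequence, which makes the
  property stable under unions.\<close>

definition rational_from_above :: "real set \<Rightarrow> bool"
  where "rational_from_above A \<longleftrightarrow>
    (\<forall>s l. (\<forall>n :: nat. s n \<in> A) \<longrightarrow> s \<longlonglongrightarrow> l \<longrightarrow> l \<in> \<rat> \<and> (\<exists>n. l \<le> s n))"

lemma eventually_infinite:
  assumes "\<forall>\<^sub>F n in sequentially. P n"
  shows "infinite {n :: nat. P n}"
proof -
  obtain k where "{k..} \<subseteq> {n. P n}" using assms unfolding eventually_sequentially by auto
  then show ?thesis using infinite_Ici infinite_super by blast
qed

lemma rational_from_above_infinite:
  assumes A: "rational_from_above A" and inf: "infinite {n :: nat. s n \<in> A}" and s: "s \<longlonglongrightarrow> l"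
  shows "l \<in> \<rat> \<and> (\<exists>n. l \<le> s n)"
proof -
  obtain r :: "nat \<Rightarrow> nat" where r: "strict_mono r" "\<And>n. r n \<in> {n. s n \<in> A}"
    using infinite_enumerate[OF inf] by blast
  have "(s \<circ> r) \<longlonglongrightarrow> l" using LIMSEQ_subseq_LIMSEQ[OF s r(1)] .
  moreover have "\<forall>n. (s \<circ> r) n \<in> A" using r(2) by simp
  ultimately have "l \<in> \<rat> \<and> (\<exists>n. l \<le> (s \<circ> r) n)"
    using A unfolding rational_from_above_def by blast
  then show ?thesis by auto
qed

lemma rational_from_above_Un:
  assumes "rational_from_above A" "rational_from_above B"
  shows "rational_from_above (A \<union> B)"
  unfolding rational_from_above_def
proof (intro allI impI)
  fix s :: "nat \<Rightarrow> real" and l assume s: "\<forall>n. s n \<in> A \<union> B" "s \<longlonglongrightarrow> l"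
  then have "UNIV = {n. s n \<in> A} \<union> {n. s n \<in> B}" by auto
  then have "infinite {n. s n \<in> A} \<or> infinite {n. s n \<in> B}"
    by (metis finite_Un infinite_UNIV_nat)
  then show "l \<in> \<rat> \<and> (\<exists>n. l \<le> s n)"
    using rational_from_above_infinite assms s(2) by blast
qed

lemma rational_from_above_mono:
  "rational_from_above B \<Longrightarrow> A \<subseteq> B \<Longrightarrow> rational_from_above A"
  unfolding rational_from_above_def by blast

text \<open>Finite sets are closed, so the limit lies in \<open>A\<close>; the part of
  \<open>A\<close> strictly below \<open>l\<close> is closed too and cannot have \<open>l\<close> as
  a limit.\<close>

lemma rational_from_above_finite:
  assumes "finite A" "A \<subseteq> \<rat>"
  shows "rational_from_above A"
  unfolding rational_from_above_def
proof (intro allI impI)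
  fix s :: "nat \<Rightarrow> real" and l assume s: "\<forall>n. s n \<in> A" "s \<longlonglongrightarrow> l"
  have "l \<in> A"
    using closed_sequentially[OF finite_imp_closed[OF assms(1)]] s by blast
  moreover have "\<exists>n. l \<le> s n"
  proof (rule ccontr)
    assume less: "\<nexists>n. l \<le> s n"
    define B where "B = A \<inter> {..<l}"
    have "closed B" using assms(1) by (simp add: B_def finite_imp_closed)
    moreover have "\<forall>n. s n \<in> B" using s(1) less by (auto simp: B_def not_le)
    ultimately have "l \<in> B" using closed_sequentially s(2) by blast
    then show False by (simp add: B_def)
  qed
  ultimately show "l \<in> \<rat> \<and> (\<exists>n. l \<le> s n)" using assms(2) by blast
qed

section \<open>Groups with a large centre modulo a bounded normal subgroup\<close>

lemma square_fractions_finite: "finite (square_fractions \<eta>)"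
  by (simp add: square_fractions_def)

lemma square_fractions_rational: "square_fractions \<eta> \<subseteq> \<rat>"
  by (auto simp: square_fractions_def intro!: Rats_divide Rats_power)

text \<open>Both bounds are uniform: \<open>N\<close> has order at most \<open>m\<close>, and for
  positive \<open>\<eta>\<close> the centre of \<open>G / N\<close> has index at most
  \<open>1 / \<eta>\<close>.\<close>

definition almost_central_probs :: "nat \<Rightarrow> real \<Rightarrow> real set"
  where "almost_central_probs m \<eta> = {commuting_prob G | G :: nat monoid. group G \<and> finite (carrier G) \<and>
    (\<exists>N. N \<lhd> G \<and> card N \<le> m \<and> \<eta> \<le> fin_group.density G (fin_group.zmod G N))}"

lemma fin_groupI: "group G \<Longrightarrow> finite (carrier G) \<Longrightarrow> fin_group G"
  by (simp add: fin_group_def fin_group_axioms_def)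

text \<open>Induction on \<open>m\<close> for all \<open>\<eta>\<close> at once, since descent
  lowers the order of \<open>N\<close> at the price of a smaller density. If no
  \<open>\<eta>'\<close> puts infinitely many terms into the family for \<open>m\<close>, descent
  eventually fails for every fixed \<open>\<delta>\<close>.\<close>

lemma almost_central_rational_from_above:
  "0 < \<eta> \<Longrightarrow> rational_from_above (almost_central_probs m \<eta>)"
proof (induction m arbitrary: \<eta>)
  case 0
  have "almost_central_probs 0 \<eta> = {}"
  proof -
    have False if "group G" "finite (carrier G)" "N \<lhd> G" "card N \<le> 0" for G :: "nat monoid" and N
    proof -
      have "subgroup N G" using that normal_imp_subgroup by blast
      then have "finite N" "N \<noteq> {}"
        using subgroup.subset subgroup.one_closed that(2) finite_subset by fast+
      then show False using that(4) by simp
    qed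
    then show ?thesis unfolding almost_central_probs_def by blast
  qed
  then show ?case by (simp add: rational_from_above_def)
next
  case (Suc m)
  show ?case
    unfolding rational_from_above_def
  proof (intro allI impI)
    fix s :: "nat \<Rightarrow> real" and l
    assume s: "\<forall>n. s n \<in> almost_central_probs (Suc m) \<eta>" "s \<longlonglongrightarrow> l"
    show "l \<in> \<rat> \<and> (\<exists>n. l \<le> s n)"
    proof (cases "\<exists>\<eta>'>0. infinite {n. s n \<in> almost_central_probs m \<eta>'}")
      case True
      then show ?thesis using rational_from_above_infinite Suc.IH s(2) by blast
    next
      case False
      then have small: "\<forall>\<^sub>F n in sequentially. s n \<notin> almost_central_probs m \<eta>'"
        if "0 < \<eta>'" for \<eta>'
        using that by (auto simp: eventually_cofinite simp flip: cofinite_eq_sequentially)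
      have "\<forall>n. \<exists>G N. s n = commuting_prob G \<and> group (G :: nat monoid) \<and> finite (carrier G) \<and>
        N \<lhd> G \<and> card N \<le> Suc m \<and> \<eta> \<le> fin_group.density G (fin_group.zmod G N)"
        using s(1) unfolding almost_central_probs_def by blast
      then obtain G N where GN: "\<And>n. s n = commuting_prob (G n :: nat monoid)" "\<And>n. group (G n)"
        "\<And>n. finite (carrier (G n))" "\<And>n. N n \<lhd> G n" "\<And>n. card (N n) \<le> Suc m"
        "\<And>n. \<eta> \<le> fin_group.density (G n) (fin_group.zmod (G n) (N n))"
        by metis
      have fg: "fin_group (G n)" for n using fin_groupI GN by blast
      have inI: "s n \<in> almost_central_probs m \<eta>'"
        if "N' \<lhd> G n" "card N' \<le> m" "\<eta>' \<le> fin_group.density (G n) (fin_group.zmod (G n) N')" for n \<eta>' N'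
        using that GN unfolding almost_central_probs_def by blast
      define q where "q = (\<lambda>n. fin_group.prob_cmt_in (G n) (N n))"
      have "range q \<subseteq> square_fractions \<eta>"
        using fin_group.prob_cmt_in_square_fraction[OF fg GN(4) Suc.prems GN(6)] by (auto simp: q_def)
      then have "finite (range q)" using square_fractions_finite finite_subset by blast
      \<comment> \<open>Only finitely many values of \<open>q\<close> occur, so one of them is
        constant along a subsequence; it will determine the limit.\<close>
      then obtain n0 where "infinite {n. q n = q n0}"
        using pigeonhole_infinite[of UNIV q] by auto
      then obtain r :: "nat \<Rightarrow> nat" where r: "strict_mono r" "\<And>n. q (r n) = q n0"
        using infinite_enumerate[of "{n. q n = q n0}"] by auto
      let ?q = "q n0 / Suc m"
      \<comment> \<open>An \<open>N n\<close> of smaller order would put \<open>s n\<close> into the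
        family for \<open>m\<close>.\<close>
      have full: "\<forall>\<^sub>F n in sequentially. card (N n) = Suc m"
        using small[OF Suc.prems]
      proof eventually_elim
        case (elim n)
        then show ?case using inI[of "N n" n \<eta>] GN(4-6)[of n] by linarith
      qed
      have lower: "?q \<le> s (r n)" if "card (N (r n)) = Suc m" for n
      proof -
        have "finite (N (r n))" using that card.infinite by fastforce
        then have "q n0 \<le> Suc m * s (r n)"
          using fin_group.prob_cmt_in_le[OF fg, of "N (r n)" "r n"] that r(2)[of n] GN(1)[of "r n"]
          by (simp add: q_def)
        then show ?thesis by (simp add: field_simps)
      qed
      \<comment> \<open>The descent alternative of \<open>commuting_prob_dichotomy\<close> is
        excluded by \<open>small\<close>, taken at the density that descent would yield for this
        \<open>\<delta>\<close>.\<close>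
      have upper: "\<forall>\<^sub>F n in sequentially. s (r n) \<le> ?q + \<delta>"
        if "0 < \<delta>" for \<delta>
      proof -
        have "0 < descent_density (Suc m) \<eta> \<delta>"
          using descent_density_pos Suc.prems that by simp
        from eventually_subseq[OF r(1) small[OF this]] eventually_subseq[OF r(1) full]
        show ?thesis
        proof eventually_elim
          case (elim n)
          then show ?case
            using fin_group.commuting_prob_dichotomy[OF fg GN(4) elim(2) Suc.prems GN(6) that]
              inI[of _ "r n"] r(2)[of n] GN(1)[of "r n"] by (auto simp: q_def)
        qed
      qed
      have low: "\<forall>\<^sub>F n in sequentially. ?q \<le> s (r n)"
        using eventually_subseq[OF r(1) full] lower by (auto elim: eventually_mono)
      have "(s \<circ> r) \<longlonglongrightarrow> ?q"
      proof (rule tendstoI)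
        fix e :: real assume "0 < e"
        then have "\<forall>\<^sub>F n in sequentially. s (r n) \<le> ?q + e / 2" using upper by simp
        then show "\<forall>\<^sub>F n in sequentially. dist ((s \<circ> r) n) ?q < e"
          using low by eventually_elim (use \<open>0 < e\<close> in \<open>simp add: dist_real_def\<close>)
      qed
      then have l: "l = ?q" using LIMSEQ_subseq_LIMSEQ[OF s(2) r(1)] LIMSEQ_unique by blast
      have "q n0 \<in> \<rat>" using \<open>range q \<subseteq> _\<close> square_fractions_rational by blast
      then have "l \<in> \<rat>" unfolding l by (intro Rats_divide Rats_of_nat)
      moreover obtain n where "?q \<le> s (r n)" using low eventually_happens by fastforce
      ultimately show ?thesis using l by blast
    qed
  qed
qed

text \<open>All values exceed \<open>1 / 4\<close>, and only finitely many of them stay away from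
  it.\<close>

lemma rational_from_above_quarter:
  "rational_from_above {1 / 4 + 3 / (4 * real m) | m :: nat. 0 < m}"
  unfolding rational_from_above_def
proof (intro allI impI)
  fix s :: "nat \<Rightarrow> real" and l
  assume s: "\<forall>n. s n \<in> {1 / 4 + 3 / (4 * real m) | m :: nat. 0 < m}" "s \<longlonglongrightarrow> l"
  then have "\<forall>n. \<exists>m>0. s n = 1 / 4 + 3 / (4 * real m)" by blast
  then obtain m where m: "\<And>n. 0 < m n" "\<And>n. s n = 1 / 4 + 3 / (4 * real (m n))" by metis
  have ge: "1 / 4 \<le> s n" for n using m by simp
  show "l \<in> \<rat> \<and> (\<exists>n. l \<le> s n)"
  proof (cases "l = 1 / 4")
    case True
    have "l \<in> \<rat>" unfolding True by simp
    then show ?thesis using ge True by blast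
  next
    case False
    have "1 / 4 \<le> l" using LIMSEQ_le_const[OF s(2)] ge by blast
    then have l: "1 / 4 < l" using False by simp
    \<comment> \<open>Half the distance from \<open>1 / 4\<close> to \<open>l\<close>: terms above
      \<open>1 / 4 + ?c\<close> force \<open>m n < 3 / (4 * ?c)\<close>.\<close>
    let ?c = "(l - 1 / 4) / 2"
    let ?A = "(\<lambda>m. 1 / 4 + 3 / (4 * real m)) ` {..nat \<lceil>3 / (4 * ?c)\<rceil>}"
    have "\<forall>\<^sub>F n in sequentially. s n > 1 / 4 + ?c"
      by (rule order_tendstoD(1)[OF s(2)]) (use l in \<open>simp add: field_simps\<close>)
    then have "\<forall>\<^sub>F n in sequentially. s n \<in> ?A"
    proof eventually_elim
      case (elim n)
      then have "?c < 3 / (4 * real (m n))" using m(2)[of n] by simp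
      then have "real (m n) < 3 / (4 * ?c)" using m(1)[of n] l by (simp add: field_simps)
      then have "m n \<le> nat \<lceil>3 / (4 * ?c)\<rceil>" by linarith
      then show ?case using m(2)[of n] by blast
    qed
    then have "infinite {n. s n \<in> ?A}" by (rule eventually_infinite)
    moreover have "rational_from_above ?A"
      by (rule rational_from_above_finite) (auto intro!: Rats_add Rats_divide Rats_mult)
    ultimately show ?thesis using rational_from_above_infinite s(2) by blast
  qed
qed

section \<open>Groups with bounded conjugacy classes\<close>

text \<open>\<open>w\<close> bounds the density of an intersection of at most
  \<open>k + k\<^sup>2\<close> centralisers, each of density at least \<open>1 / k\<close>; the
  outer power is the cost of passing to the core.\<close>

definition bfc_density :: "nat \<Rightarrow> real"
  where "bfc_density k = (let w = (1 / k) ^ (k + k\<^sup>2) in w ^ nat \<lceil>1 / w\<rceil>)"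

lemma bfc_density_pos: "0 < k \<Longrightarrow> 0 < bfc_density k"
  by (simp add: bfc_density_def Let_def)

context fin_group begin

text \<open>Within the commutative \<open>K\<close>, a product of two subgroups is a subgroup whose
  order is at most the product of their orders. Minimality is recorded because \<open>bfc\<close>
  deduces normality from it.\<close>

lemma commuting_subgroups_product:
  assumes K: "subgroup K G" "\<And>a b. a \<in> K \<Longrightarrow> b \<in> K \<Longrightarrow> a \<otimes> b = b \<otimes> a"
    and "finite \<A>" "\<And>A. A \<in> \<A> \<Longrightarrow> subgroup A G \<and> A \<subseteq> K \<and> card A \<le> k"
  shows "\<exists>N. subgroup N G \<and> N \<subseteq> K \<and> \<Union>\<A> \<subseteq> N \<and> card N \<le> k ^ card \<A> \<and>
    (\<forall>M. subgroup M G \<longrightarrow> \<Union>\<A> \<subseteq> M \<longrightarrow> N \<subseteq> M)"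
  using assms(3,4)
proof (induction \<A>)
  case empty
  show ?case
    using triv_subgroup subgroup.one_closed[OF K(1)] subgroup.one_closed
    by (intro exI[of _ "{\<one>}"]) auto
next
  case (insert A \<A>)
  have KG: "K \<subseteq> carrier G" using K(1) by (rule subgroup.subset)
  have A: "subgroup A G" "A \<subseteq> K" "card A \<le> k" using insert.prems by auto
  obtain N where N: "subgroup N G" "N \<subseteq> K" "\<Union>\<A> \<subseteq> N" "card N \<le> k ^ card \<A>"
    "\<And>M. subgroup M G \<Longrightarrow> \<Union>\<A> \<subseteq> M \<Longrightarrow> N \<subseteq> M"
    using insert.IH insert.prems by (metis insertI2)
  define P where "P = (\<lambda>(a, n). a \<otimes> n) ` (A \<times> N)"
  have PI: "a \<otimes> n \<in> P" if "a \<in> A" "n \<in> N" for a n using that by (auto simp: P_def)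
  have PK: "P \<subseteq> K" using A(2) N(2) subgroup.m_closed[OF K(1)] by (auto simp: P_def)
  have AP: "A \<subseteq> P"
  proof
    fix a assume a: "a \<in> A"
    then have "a \<in> carrier G" using A(2) KG by blast
    then show "a \<in> P" using PI[OF a subgroup.one_closed[OF N(1)]] by simp
  qed
  have NP: "N \<subseteq> P"
  proof
    fix n assume n: "n \<in> N"
    then have "n \<in> carrier G" using N(2) KG by blast
    then show "n \<in> P" using PI[OF subgroup.one_closed[OF A(1)] n] by simp
  qed
  have sub: "subgroup P G"
  proof (rule finite_subgroupI)
    show "P \<subseteq> carrier G" using PK KG by blast
    show "P \<noteq> {}" using NP subgroup.one_closed[OF N(1)] by blast
    fix p q assume "p \<in> P" "q \<in> P"
    then obtain a n b m where e: "a \<in> A" "n \<in> N" "p = a \<otimes> n" "b \<in> A" "m \<in> N" "q = b \<otimes> m"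
      by (auto simp: P_def)
    then have c: "a \<in> carrier G" "b \<in> carrier G" "n \<in> carrier G" "m \<in> carrier G"
      using A(2) N(2) KG by auto
    have "p \<otimes> q = a \<otimes> (n \<otimes> b) \<otimes> m" using e c by (simp add: m_assoc)
    also have "n \<otimes> b = b \<otimes> n" using K(2) e A(2) N(2) by blast
    also have "a \<otimes> (b \<otimes> n) \<otimes> m = (a \<otimes> b) \<otimes> (n \<otimes> m)"
      using c by (simp add: m_assoc)
    finally show "p \<otimes> q \<in> P"
      using PI subgroup.m_closed[OF A(1) e(1,4)] subgroup.m_closed[OF N(1) e(2,5)] by simp
  qed
  have fAN: "finite (A \<times> N)" using A(2) N(2) KG by (simp add: subset_trans)
  have "card P \<le> card A * card N"
    unfolding P_def using card_image_le[OF fAN] by (simp add: card_cartesian_product)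
  also have "\<dots> \<le> k * k ^ card \<A>" using A(3) N(4) by (rule mult_le_mono)
  finally have card: "card P \<le> k ^ card (insert A \<A>)" using insert.hyps by simp
  have least: "P \<subseteq> M" if "subgroup M G" "\<Union>(insert A \<A>) \<subseteq> M" for M
  proof -
    have "A \<subseteq> M" "N \<subseteq> M" using that N(5)[of M] by auto
    then show ?thesis using subgroup.m_closed[OF that(1)] by (auto simp: P_def)
  qed
  have "\<Union>(insert A \<A>) \<subseteq> P" using AP NP N(3) by auto
  then show ?case using sub PK card least by blast
qed

text \<open>Let \<open>x\<close> have the largest class. The elements of \<open>U\<close>, which
  centralise \<open>Y\<close>, have all their commutators in the bounded set \<open>T\<close>, and
  \<open>H\<close> is the core of the part of \<open>U\<close> that centralises \<open>T\<close>.
  For each \<open>g\<close> the commutators of \<open>H\<close> with \<open>g\<close> form a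
  subgroup inside \<open>T\<close>; these subgroups commute, and \<open>N\<close> is their
  product.\<close>

lemma bfc:
  assumes k: "\<And>x. x \<in> carrier G \<Longrightarrow> card (cmt x ` carrier G) \<le> k"
  shows "\<exists>N. N \<lhd> G \<and> card N \<le> (k\<^sup>2) ^ 2 ^ k\<^sup>2 \<and> bfc_density k \<le> density (zmod N)"
proof -
  let ?f = "\<lambda>x. card (cmt x ` carrier G)"
  have neC: "carrier G \<noteq> {}" by auto
  then have "Max (?f ` carrier G) \<in> ?f ` carrier G" by (intro Max_in) auto
  then obtain x where x: "x \<in> carrier G" "?f x = Max (?f ` carrier G)" by fastforce
  have max: "?f y \<le> ?f x" if "y \<in> carrier G" for y using that unfolding x(2) by (intro Max_ge) auto
  define I where "I = cmt x ` carrier G"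
  have II: "cmt x g \<in> I" if "g \<in> carrier G" for g using that by (simp add: I_def)
  have IG: "I \<subseteq> carrier G" using x(1) by (auto simp: I_def)
  have fI: "finite I" using IG by simp
  have "card I > 0" using neC fI by (simp add: card_gt_0_iff I_def)
  moreover have cI: "card I \<le> k" using k[OF x(1)] by (simp add: I_def)
  ultimately have kpos: "0 < k" by linarith
  have dc: "1 / real k \<le> density (cent y)" if "y \<in> carrier G" for y
    using that k by (intro density_cent[where B = "cmt y ` carrier G"]) auto
  \<comment> \<open>One element for each commutator of \<open>x\<close>, so that at most
    \<open>k\<close> centralisers are intersected in \<open>U\<close>.\<close>
  define Y where "Y = inv_into (carrier G) (cmt x) ` I"
  have YG: "Y \<subseteq> carrier G" by (auto simp: Y_def I_def inv_into_into)
  have YI: "cmt x ` Y = I" unfolding Y_def I_def image_image by (simp add: f_inv_into_f)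
  have cY: "card Y \<le> k" unfolding Y_def using cI by (intro card_image_le[OF fI, THEN le_trans])
  define U where "U = carrier G \<inter> (\<Inter>y\<in>Y. cent y)"
  have U: "subgroup U G" "(1 / k) ^ card Y \<le> density U"
    using density_INT[of Y "carrier G" "1 / k" cent] YG dc subgroup_self by (auto simp: U_def subset_iff)
  have UG: "U \<subseteq> carrier G" by (auto simp: U_def)
  define T where "T = (\<lambda>(s, t). inv s \<otimes> t) ` (I \<times> I)"
  have TG: "T \<subseteq> carrier G" using IG by (auto simp: T_def)
  have "card T \<le> card I * card I"
    unfolding T_def using card_image_le[of "I \<times> I"] fI by (simp add: card_cartesian_product)
  also have "\<dots> \<le> k * k" using cI by (intro mult_le_mono)
  finally have cT: "card T \<le> k\<^sup>2" by (simp add: power2_eq_square)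
  have Tinv: "inv t \<in> T" if "t \<in> T" for t
  proof -
    obtain a b where ab: "a \<in> I" "b \<in> I" "t = inv a \<otimes> b"
      using \<open>t \<in> T\<close> unfolding T_def by auto
    then have "inv t = inv b \<otimes> a"
      using subsetD[OF IG ab(1)] subsetD[OF IG ab(2)] by (simp add: inv_mult_group)
    then show ?thesis using ab unfolding T_def by force
  qed
  \<comment> \<open>As \<open>x\<close> has the largest class, \<open>v x\<close> has no commutators besides the conjugates by \<open>v\<close> of those of
    \<open>x\<close>, which already arise from \<open>Y\<close>.\<close>
  have cmtT: "cmt g (inv v) \<in> T" if v: "v \<in> U" and g: "g \<in> carrier G" for v g
  proof -
    have vG: "v \<in> carrier G" using v UG by blast
    let ?c = "\<lambda>t. v \<otimes> t \<otimes> inv v"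
    have inj: "inj_on ?c I" using vG subsetD[OF IG] by (auto intro!: inj_onI)
    have "?c ` I \<subseteq> cmt (v \<otimes> x) ` carrier G"
    proof (rule image_subsetI)
      fix t assume "t \<in> I"
      then obtain y where y: "y \<in> Y" "t = cmt x y" using YI by blast
      then have yG: "y \<in> carrier G" using YG by blast
      have "v \<in> cent y" using v y(1) by (auto simp: U_def)
      then have "cmt v y = \<one>" using vG yG by (simp add: cmt_eq_one_iff cent_def)
      then have "?c t = cmt (v \<otimes> x) y" using vG yG x(1) y(2) by (simp add: cmt_mult_left)
      then show "?c t \<in> cmt (v \<otimes> x) ` carrier G" using yG by blast
    qed
    moreover have "card (cmt (v \<otimes> x) ` carrier G) \<le> card (?c ` I)"
      using max[of "v \<otimes> x"] vG x(1) inj by (simp add: card_image I_def)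
    ultimately have eq: "?c ` I = cmt (v \<otimes> x) ` carrier G"
      by (intro card_seteq) auto
    obtain t where t: "t \<in> I" "cmt (v \<otimes> x) g = ?c t" using eq g by blast
    have tG: "t \<in> carrier G" using t(1) IG by blast
    \<comment> \<open>Expand \<open>cmt (v \<otimes> x) g\<close> and conjugate by
      \<open>inv v\<close>: the factor \<open>cmt v g\<close> becomes \<open>cmt g (inv v)\<close>,
      which explains the inverse in the claim.\<close>
    have "cmt g (inv v) = inv (cmt x g) \<otimes> (inv v \<otimes> (cmt (v \<otimes> x) g) \<otimes> v)"
      using vG g x(1) by (simp add: cmt_def m_assoc inv_mult_group)
    also have "\<dots> = inv (cmt x g) \<otimes> t"
      unfolding t(2) using vG tG g x(1) by (simp add: m_assoc)
    finally show ?thesis using II[OF g] t(1) unfolding T_def by force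
  qed
  have UT: "cmt u g \<in> T" if u: "u \<in> U" and g: "g \<in> carrier G" for u g
  proof -
    have uG: "u \<in> carrier G" using u UG by blast
    have "cmt g (inv (inv u)) \<in> T" using cmtT[OF subgroup.m_inv_closed[OF U(1) u] g] .
    then have "inv (cmt g u) \<in> T" using uG Tinv by simp
    then show ?thesis using inv_cmt[OF g uG] by simp
  qed
  define W where "W = U \<inter> (\<Inter>t\<in>T. cent t)"
  let ?w = "(1 / real k) ^ (k + k\<^sup>2)"
  have W: "subgroup W G" "density U * (1 / k) ^ card T \<le> density W"
    using density_INT[of T U "1 / k" cent] TG dc U(1) by (auto simp: W_def subset_iff)
  have "?w = (1 / k) ^ k * (1 / k) ^ k\<^sup>2" by (rule power_add)
  also have "\<dots> \<le> (1 / k) ^ card Y * (1 / k) ^ card T"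
    using kpos cY cT by (intro mult_mono power_decreasing) auto
  also have "\<dots> \<le> density U * (1 / k) ^ card T" using U(2) by (intro mult_right_mono) auto
  also have "\<dots> \<le> density W" by (rule W(2))
  finally have w: "?w \<le> density W" .
  define H where "H = core W"
  have Hn: "H \<lhd> G" unfolding H_def using W(1) by (rule core_normal)
  have H: "subgroup H G" using Hn by (rule normal_imp_subgroup)
  have Hconj: "g \<otimes> h \<otimes> inv g \<in> H" if "g \<in> carrier G" "h \<in> H" for g h
    using Hn that unfolding normal_inv_iff by blast
  have HG: "H \<subseteq> carrier G" using H by (rule subgroup.subset)
  have HW: "H \<subseteq> W" unfolding H_def by (rule core_sub)
  have Hd: "bfc_density k \<le> density H"
    unfolding bfc_density_def Let_def H_def using kpos w by (intro density_core W(1)) auto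
  have HT: "cmt u g \<in> T" if "u \<in> H" "g \<in> carrier G" for u g
    using that HW UT by (auto simp: W_def)
  have TH: "t \<otimes> h = h \<otimes> t" if "t \<in> T" "h \<in> H" for t h
    using that HW by (auto simp: W_def cent_def)
  have HH: "cmt u g \<in> H" if "u \<in> H" "g \<in> carrier G" for u g
  proof -
    have uG: "u \<in> carrier G" using that HG by blast
    have "u \<otimes> (g \<otimes> inv u \<otimes> inv g) \<in> H"
      using that H Hconj by (simp add: subgroup.m_closed subgroup.m_inv_closed)
    then show ?thesis using uG that by (simp add: cmt_def m_assoc)
  qed
  \<comment> \<open>\<open>H\<close> centralises \<open>T\<close>, so \<open>u \<mapsto> [u, g]\<close> reverses products on \<open>H\<close> and the \<open>A g\<close> are commuting subgroups.\<close>
  define A where "A = (\<lambda>g. (\<lambda>u. cmt u g) ` H)"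
  define Z where "Z = H \<inter> (\<Inter>h\<in>H. cent h)"
  have Z: "subgroup Z G"
    unfolding Z_def using density_INT[of H H 0 cent] H HG by (auto simp: subset_iff)
  have Zcomm: "a \<otimes> b = b \<otimes> a" if "a \<in> Z" "b \<in> Z" for a b
  proof -
    have "a \<in> cent b" using that by (simp add: Z_def)
    then show ?thesis by (simp add: cent_def)
  qed
  have AT: "A g \<subseteq> T" if "g \<in> carrier G" for g using HT that by (auto simp: A_def)
  have AZ: "A g \<subseteq> Z" if g: "g \<in> carrier G" for g
  proof
    fix a assume a: "a \<in> A g"
    then have aHT: "a \<in> H" "a \<in> T" using HH HT g by (auto simp: A_def)
    then have "a \<in> carrier G" using HG by blast
    then have "a \<in> cent h" if "h \<in> H" for h using TH[OF aHT(2) that] by (simp add: cent_def)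
    then show "a \<in> Z" using aHT(1) by (simp add: Z_def)
  qed
  have As: "subgroup (A g) G" if g: "g \<in> carrier G" for g
  proof (rule finite_subgroupI)
    show "A g \<subseteq> carrier G" using AT[OF g] TG by blast
    show "A g \<noteq> {}" using subgroup.one_closed[OF H] by (auto simp: A_def)
    fix a b assume "a \<in> A g" "b \<in> A g"
    then obtain u v where uv: "u \<in> H" "v \<in> H" "a = cmt u g" "b = cmt v g" by (auto simp: A_def)
    then have c: "u \<in> carrier G" "v \<in> carrier G" using HG by auto
    have "v \<otimes> cmt u g \<otimes> inv v = cmt u g"
      using TH[OF HT[OF uv(1) g] uv(2)] c g by (intro conj_commuting) auto
    then have "a \<otimes> b = cmt (v \<otimes> u) g" using uv c g by (simp add: cmt_mult_left)
    then show "a \<otimes> b \<in> A g" using subgroup.m_closed[OF H uv(2,1)] by (auto simp: A_def)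
  qed
  have fT: "finite T" using TG by simp
  have Acard: "card (A g) \<le> k\<^sup>2" if "g \<in> carrier G" for g
    using card_mono[OF fT AT[OF that]] cT by linarith
  obtain N where N: "subgroup N G" "\<Union>(A ` carrier G) \<subseteq> N" "card N \<le> (k\<^sup>2) ^ card (A ` carrier G)"
    "\<And>M. subgroup M G \<Longrightarrow> \<Union>(A ` carrier G) \<subseteq> M \<Longrightarrow> N \<subseteq> M"
  proof -
    have "\<exists>N. subgroup N G \<and> N \<subseteq> Z \<and> \<Union>(A ` carrier G) \<subseteq> N \<and> card N \<le> (k\<^sup>2) ^ card (A ` carrier G) \<and>
      (\<forall>M. subgroup M G \<longrightarrow> \<Union>(A ` carrier G) \<subseteq> M \<longrightarrow> N \<subseteq> M)"
      using As AZ Acard by (intro commuting_subgroups_product[OF Z Zcomm]) auto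
    then show thesis using that by blast
  qed
  \<comment> \<open>Each \<open>A g\<close> is a subset of \<open>T\<close>, so the number of
    distinct ones is bounded independently of the order of the group.\<close>
  have "card (A ` carrier G) \<le> card (Pow T)" using AT fT by (intro card_mono) auto
  also have "\<dots> = 2 ^ card T" using fT by (simp add: card_Pow)
  also have "\<dots> \<le> 2 ^ k\<^sup>2" using cT by simp
  finally have "(k\<^sup>2) ^ card (A ` carrier G) \<le> (k\<^sup>2) ^ 2 ^ k\<^sup>2"
    using kpos by (intro power_increasing) auto
  then have Nc: "card N \<le> (k\<^sup>2) ^ 2 ^ k\<^sup>2" using N(3) by linarith
  have "g \<otimes> n \<otimes> inv g \<in> N" if g: "g \<in> carrier G" and n: "n \<in> N" for g n
  proof -
    \<comment> \<open>Conjugation permutes the subgroups \<open>A y\<close>, so this subgroup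
      contains all of them and, by minimality, also \<open>N\<close>.\<close>
    let ?M = "{c \<in> carrier G. g \<otimes> c \<otimes> inv g \<in> N}"
    have "\<Union>(A ` carrier G) \<subseteq> ?M"
    proof clarify
      fix a y assume a: "a \<in> A y" and y: "y \<in> carrier G"
      then obtain u where u: "u \<in> H" "a = cmt u y" by (auto simp: A_def)
      have uG: "u \<in> carrier G" using u HG by blast
      have "g \<otimes> a \<otimes> inv g = cmt (g \<otimes> u \<otimes> inv g) (g \<otimes> y \<otimes> inv g)"
        unfolding u(2) using uG y g by (rule cmt_conj)
      also have "\<dots> \<in> A (g \<otimes> y \<otimes> inv g)"
        using Hconj[OF g u(1)] by (auto simp: A_def)
      also have "A (g \<otimes> y \<otimes> inv g) \<subseteq> N" using N(2) g y by blast
      finally show "a \<in> carrier G \<and> g \<otimes> a \<otimes> inv g \<in> N" using u uG y by simp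
    qed
    then show ?thesis using N(4)[OF conj_preimage(1)[OF N(1) g]] n by blast
  qed
  then have "N \<lhd> G" unfolding normal_inv_iff using N(1) by blast
  moreover have "H \<subseteq> zmod N" using N(2) HG by (auto simp: zmod_def A_def)
  then have "bfc_density k \<le> density (zmod N)"
    using Hd density_mono[of H "zmod N"] by (force simp: zmod_def)
  ultimately show ?thesis using Nc by blast
qed

section \<open>Commuting probability above two ninths\<close>

primrec set_power :: "'a set \<Rightarrow> nat \<Rightarrow> 'a set" where
  "set_power X 0 = {\<one>}"
| "set_power X (Suc n) = (\<lambda>(a, b). a \<otimes> b) ` (X \<times> set_power X n)"

lemma set_power_closed: "X \<subseteq> carrier G \<Longrightarrow> set_power X n \<subseteq> carrier G"
  by (induction n) auto

lemma set_power_1: "X \<subseteq> carrier G \<Longrightarrow> set_power X 1 = X"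
  by (force simp: subset_iff)

lemma set_power_mult:
  assumes X: "X \<subseteq> carrier G" and "a \<in> set_power X m" "b \<in> set_power X n"
  shows "a \<otimes> b \<in> set_power X (m + n)"
  using assms(2)
proof (induction m arbitrary: a)
  case 0
  moreover have "b \<in> carrier G" using assms(3) set_power_closed[OF X] by blast
  ultimately show ?case using assms(3) by simp
next
  case (Suc m)
  then obtain x c where c: "x \<in> X" "c \<in> set_power X m" "a = x \<otimes> c" by auto
  then have "x \<in> carrier G" "c \<in> carrier G" "b \<in> carrier G"
    using X assms(3) set_power_closed[OF X] by blast+
  then have "a \<otimes> b = x \<otimes> (c \<otimes> b)" using c(3) by (simp add: m_assoc)
  then show ?case using c(1) Suc.IH[OF c(2)] by auto
qed

lemma set_power_split:
  assumes X: "X \<subseteq> carrier G"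
  shows "c \<in> set_power X (m + n) \<Longrightarrow> \<exists>a\<in>set_power X m. \<exists>b\<in>set_power X n. c = a \<otimes> b"
proof (induction m arbitrary: c)
  case 0
  then have "c \<in> carrier G" "c \<in> set_power X n" using set_power_closed[OF X] by auto
  then show ?case by (auto intro!: bexI[of _ c])
next
  case (Suc m)
  then obtain x d where d: "x \<in> X" "d \<in> set_power X (m + n)" "c = x \<otimes> d" by auto
  then obtain a b where ab: "a \<in> set_power X m" "b \<in> set_power X n" "d = a \<otimes> b"
    using Suc.IH by blast
  then have "x \<in> carrier G" "a \<in> carrier G" "b \<in> carrier G"
    using X d(1) set_power_closed[OF X] by blast+
  then have "c = (x \<otimes> a) \<otimes> b" using d(3) ab(3) by (simp add: m_assoc)
  moreover have "x \<otimes> a \<in> set_power X (Suc m)" using d(1) ab(1) by auto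
  ultimately show ?case using ab(2) by blast
qed

text \<open>A dense set generates a subgroup quickly: were \<open>c\<close> a product of six but not of five elements
  of \<open>X\<close>, with prefix \<open>a\<close> of length three, then \<open>X\<close>, \<open>a X\<close> and \<open>c X\<close> would be disjoint.\<close>

lemma set_power_stable:
  assumes X: "X \<subseteq> carrier G" "\<one> \<in> X" "\<And>x. x \<in> X \<Longrightarrow> inv x \<in> X" "order G < 3 * card X"
  shows "set_power X 6 \<subseteq> set_power X 5"
proof
  fix c assume c: "c \<in> set_power X 6"
  show "c \<in> set_power X 5"
  proof (rule ccontr)
    assume nc: "c \<notin> set_power X 5"
    have mult: "p \<otimes> q \<in> set_power X k"
      if "p \<in> set_power X m" "q \<in> set_power X n" "k = m + n" for p q m n k
      using that set_power_mult[OF X(1)] by blast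
    have cl: "\<And>n p. p \<in> set_power X n \<Longrightarrow> p \<in> carrier G"
      using set_power_closed[OF X(1)] by blast
    have X1: "\<And>x. x \<in> X \<Longrightarrow> x \<in> set_power X 1"
      using set_power_1[OF X(1)] by blast
    have quot: "x \<otimes> inv y \<in> set_power X 2" if "x \<in> X" "y \<in> X" for x y
      by (rule mult[of _ 1 _ 1]) (use X1 that X(3) in auto)
    obtain a b where ab: "a \<in> set_power X 3" "b \<in> set_power X 3" "c = a \<otimes> b"
      using set_power_split[OF X(1), of c 3 3] c by auto
    have aG: "a \<in> carrier G" and bG: "b \<in> carrier G" and cG: "c \<in> carrier G"
      using ab c cl by blast+
    have XG: "\<And>x. x \<in> X \<Longrightarrow> x \<in> carrier G" using X(1) by blast
    let ?A = "(\<otimes>) a ` X" and ?C = "(\<otimes>) c ` X"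
    have "X \<inter> ?A = {}"
    proof (rule ccontr)
      assume "X \<inter> ?A \<noteq> {}"
      then obtain x y where xy: "x \<in> X" "y \<in> X" "x = a \<otimes> y" by blast
      then have "x \<otimes> inv y = a" using aG XG by (simp add: m_assoc)
      then have "a \<in> set_power X 2" using quot[OF xy(1,2)] by simp
      from mult[OF this ab(2)] nc ab(3) show False by simp
    qed
    moreover have "?A \<inter> ?C = {}"
    proof (rule ccontr)
      assume "?A \<inter> ?C \<noteq> {}"
      then obtain x y where xy: "x \<in> X" "y \<in> X" "a \<otimes> x = c \<otimes> y" by blast
      have "a \<otimes> (x \<otimes> inv y) = a \<otimes> x \<otimes> inv y"
        using aG XG xy(1,2) by (simp add: m_assoc)
      also have "\<dots> = c" unfolding xy(3) using cG XG xy(2) by (simp add: m_assoc)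
      finally have "c = a \<otimes> (x \<otimes> inv y)" ..
      then show False using mult[OF ab(1) quot[OF xy(1,2)]] nc by simp
    qed
    moreover have "X \<inter> ?C = {}"
    proof (rule ccontr)
      assume "X \<inter> ?C \<noteq> {}"
      then obtain x y where xy: "x \<in> X" "y \<in> X" "x = c \<otimes> y" by blast
      then have "x \<otimes> inv y = c" using cG XG by (simp add: m_assoc)
      then have "c \<in> set_power X 2" using quot[OF xy(1,2)] by simp
      moreover have "\<one> \<in> set_power X 3"
        using X(2) by (auto simp: numeral_3_eq_3 intro!: image_eqI[of _ _ "(\<one>, \<one>)"])
      ultimately have "c \<otimes> \<one> \<in> set_power X 5" by (rule mult) simp
      then show False using nc cG by simp
    qed
    moreover have "card ?A = card X" "card ?C = card X"
      using aG cG XG by (auto intro!: card_image simp: inj_on_def)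
    moreover have "finite X" "finite ?A" "finite ?C" using X(1) by auto
    ultimately have "card (X \<union> ?A \<union> ?C) = 3 * card X"
      by (simp add: card_Un_disjoint Int_Un_distrib2)
    moreover have "card (X \<union> ?A \<union> ?C) \<le> order G"
      unfolding order_def using X(1) aG cG XG by (intro card_mono) auto
    ultimately show False using X(4) by simp
  qed
qed

text \<open>Six leading factors can be replaced by five, so every longer product shortens to five
  factors; closure under multiplication is the case of ten.\<close>

lemma set_power_subgroup:
  assumes X: "X \<subseteq> carrier G" "\<one> \<in> X" "\<And>x. x \<in> X \<Longrightarrow> inv x \<in> X" "order G < 3 * card X"
  shows "subgroup (set_power X 5) G"
proof (rule finite_subgroupI)
  have stab: "set_power X (5 + j) \<subseteq> set_power X 5" for j
  proof (induction j)
    case (Suc j)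
    show ?case
    proof
      fix c assume "c \<in> set_power X (5 + Suc j)"
      then have "c \<in> set_power X (6 + j)" by (simp only: add_Suc_right) simp
      then obtain a b where ab: "a \<in> set_power X 6" "b \<in> set_power X j" "c = a \<otimes> b"
        using set_power_split[OF X(1)] by blast
      then have "a \<in> set_power X 5" using set_power_stable[OF X] by blast
      then have "c \<in> set_power X (5 + j)" using ab set_power_mult[OF X(1)] by blast
      then show "c \<in> set_power X 5" using Suc.IH by blast
    qed
  qed simp
  show "set_power X 5 \<subseteq> carrier G" by (rule set_power_closed[OF X(1)])
  have "\<one> \<in> set_power X n" for n
    by (induction n) (use X(2) in \<open>auto intro!: image_eqI[of _ _ "(\<one>, \<one>)"]\<close>)
  then show "set_power X 5 \<noteq> {}" by blast
  show "a \<otimes> b \<in> set_power X 5" if "a \<in> set_power X 5" "b \<in> set_power X 5" for a b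
    using set_power_mult[OF X(1) that] stab[of 5] by blast
qed

lemma cent_sym: "x \<in> carrier G \<Longrightarrow> y \<in> cent x \<Longrightarrow> x \<in> cent y"
  by (simp add: cent_def)

text \<open>Whatever centralises two elements centralises their product, so each further factor
  costs at most a factor \<open>\<eta>\<close>.\<close>

lemma set_power_cent_density:
  assumes X: "X \<subseteq> carrier G" "\<And>x. x \<in> X \<Longrightarrow> \<eta> \<le> density (cent x)" and "0 \<le> \<eta>"
  shows "x \<in> set_power X n \<Longrightarrow> \<eta> ^ n \<le> density (cent x)"
proof (induction n arbitrary: x)
  case 0
  have "cent \<one> = carrier G" by (auto simp: cent_def)
  then show ?case using 0 by simp
next
  case (Suc n)
  then obtain a b where ab: "a \<in> X" "b \<in> set_power X n" "x = a \<otimes> b" by auto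
  then have c: "a \<in> carrier G" "b \<in> carrier G" using X(1) set_power_closed[OF X(1)] by blast+
  have "\<eta> ^ Suc n \<le> density (cent a) * density (cent b)"
    unfolding power_Suc using X(2)[OF ab(1)] Suc.IH[OF ab(2)] assms(3) by (intro mult_mono) auto
  also have "\<dots> \<le> density (cent a \<inter> cent b)" using c by (intro density_Int) auto
  also have "\<dots> \<le> density (cent x)"
  proof (rule density_mono)
    show "cent a \<inter> cent b \<subseteq> cent x"
    proof
      fix y assume y: "y \<in> cent a \<inter> cent b"
      then have "y \<in> carrier G" "a \<in> cent y" "b \<in> cent y"
        using c cent_sym by (auto simp: cent_def)
      then have "x \<in> cent y" using ab(3) subgroup.m_closed[OF cent_subgroup] by blast
      then show "y \<in> cent x" using \<open>y \<in> carrier G\<close> cent_sym by blast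
    qed
  qed simp
  finally show ?case .
qed

section \<open>Proper subgroups and abelian subgroups of index two\<close>

lemma subgroup_cancel_left:
  assumes "subgroup H G" "a \<in> H" "a \<otimes> b \<in> H" "b \<in> carrier G"
  shows "b \<in> H"
proof -
  have "inv a \<otimes> (a \<otimes> b) \<in> H"
    using assms subgroup.m_closed subgroup.m_inv_closed by metis
  moreover have "a \<in> carrier G" using assms(1,2) subgroup.mem_carrier by metis
  ultimately show ?thesis using assms(4) by simp
qed

lemma card_rcoset: "A \<subseteq> carrier G \<Longrightarrow> b \<in> carrier G \<Longrightarrow> card (A #> b) = card A"
  using card_rcosets_equal[OF rcosetsI, of A b] by simp

lemma card_proper_subgroup:
  assumes A: "subgroup A G" and B: "subgroup B G" and AB: "A \<subset> B"
  shows "2 * card A \<le> card B"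
proof -
  have BG: "B \<subseteq> carrier G" using B by (rule subgroup.subset)
  obtain b where b: "b \<in> B" "b \<notin> A" using AB by blast
  have bG: "b \<in> carrier G" using b BG by blast
  have AG: "A \<subseteq> carrier G" using AB BG by blast
  have "A \<inter> (A #> b) = {}"
  proof (rule ccontr)
    assume "A \<inter> (A #> b) \<noteq> {}"
    then obtain a c where ac: "a \<in> A" "c \<in> A" "c = a \<otimes> b" by (auto simp: r_coset_def)
    then have "b \<in> A" using subgroup_cancel_left[OF A] bG by metis
    then show False using b by blast
  qed
  moreover have "card (A #> b) = card A"
    using card_rcoset[OF AG bG] .
  moreover have sub: "A #> b \<subseteq> B"
    using b(1) AB subgroup.m_closed[OF B] by (auto simp: r_coset_def)
  moreover have "finite A" "finite (A #> b)" using AG sub BG by auto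
  ultimately have "card (A \<union> (A #> b)) = 2 * card A" by (simp add: card_Un_disjoint)
  moreover have "card (A \<union> (A #> b)) \<le> card B" using AB sub BG by (intro card_mono) auto
  ultimately show ?thesis by simp
qed

text \<open>With \<open>Z\<close> the central elements in \<open>F\<close>, centralisers have order
  \<open>2 * card F\<close> on \<open>Z\<close>, \<open>card F\<close> on \<open>F - Z\<close> and
  \<open>2 * card Z\<close> outside \<open>F\<close>. The integer \<open>m\<close> is the index of
  \<open>Z\<close> in \<open>F\<close>.\<close>

lemma commuting_prob_abelian_index_2:
  assumes F: "subgroup F G" "order G = 2 * card F"
    and comm: "\<And>a b. a \<in> F \<Longrightarrow> b \<in> F \<Longrightarrow> a \<otimes> b = b \<otimes> a"
  shows "\<exists>m>0. commuting_prob G = 1 / 4 + 3 / (4 * real m)"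
proof -
  have FG: "F \<subseteq> carrier G" using F(1) by (rule subgroup.subset)
  define Z where "Z = F \<inter> (\<Inter>g\<in>carrier G. cent g)"
  have Z: "subgroup Z G" unfolding Z_def using density_INT[of "carrier G" F 0 cent] F(1) by auto
  have ZF: "Z \<subseteq> F" by (auto simp: Z_def)
  have "card Z dvd card F"
    using card_invariant_dvd[OF is_group fin Z FG] subgroup.m_closed[OF F(1)] ZF by blast
  then obtain m where m: "card F = card Z * m" by auto
  have pos: "card F > 0" using F(2) order_pos by linarith
  then have mpos: "m > 0" "card Z > 0" using m by auto
  \<comment> \<open>A subgroup strictly larger than one of index two is the whole group.\<close>
  have big: "cent z = carrier G" if "F \<subset> cent z" "z \<in> carrier G" for z
  proof -
    have "order G \<le> card (cent z)"
      using card_proper_subgroup[OF F(1) _ that(1)] that(2) F(2) by simp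
    then show ?thesis by (intro card_seteq) (auto simp: order_def)
  qed
  have Fcent: "F \<subseteq> cent x" if "x \<in> F" for x using comm that FG by (auto simp: cent_def)
  have inZ: "z \<in> Z" if "z \<in> F" "cent z = carrier G" for z
    using that FG cent_sym[of z] by (auto simp: Z_def)
  have c1: "card (cent x) = 2 * card F" if "x \<in> Z" for x
  proof -
    have "cent x = carrier G" using that FG cent_sym by (auto simp: Z_def cent_def)
    then show ?thesis using F(2) by (simp add: order_def)
  qed
  have c2: "card (cent x) = card F" if "x \<in> F - Z" for x
  proof -
    have "\<not> F \<subset> cent x" using big[of x] inZ[of x] that FG by blast
    then have "cent x = F" using Fcent that by blast
    then show ?thesis by simp
  qed
  have c3: "card (cent x) = 2 * card Z" if x: "x \<in> carrier G - F" for x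
  proof -
    have xG: "x \<in> carrier G" using x by blast
    \<comment> \<open>Such a \<open>z\<close> commutes with \<open>F\<close> and with
      \<open>x\<close>, which lies outside \<open>F\<close>, so \<open>big\<close> makes it
      central.\<close>
    have FZ: "z \<in> Z" if "z \<in> F" "z \<in> cent x" for z
    proof -
      have "x \<in> cent z" using cent_sym[OF xG] that by blast
      then have "F \<subset> cent z" using Fcent[OF that(1)] x by blast
      then show ?thesis using big inZ that FG by blast
    qed
    have disj: "F \<inter> (F #> x) = {}"
    proof (rule ccontr)
      assume "F \<inter> (F #> x) \<noteq> {}"
      then obtain f g where fg: "f \<in> F" "g \<in> F" "f = g \<otimes> x" by (auto simp: r_coset_def)
      then have "x \<in> F" using subgroup_cancel_left[OF F(1)] xG by metis
      then show False using x by blast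
    qed
    have sub: "F #> x \<subseteq> carrier G" using r_coset_subset_G[OF FG xG] .
    have cF: "card (F #> x) = card F" and cZ: "card (Z #> x) = card Z"
      using card_rcoset[OF FG xG] card_rcoset[OF subset_trans[OF ZF FG] xG] by auto
    have "card (F \<union> (F #> x)) = order G"
      using disj cF F(2) FG sub by (simp add: card_Un_disjoint)
    then have cover: "F \<union> (F #> x) = carrier G"
      using FG sub by (intro card_seteq) (auto simp: order_def)
    have "cent x = Z \<union> (Z #> x)"
    proof (intro equalityI subsetI)
      fix y assume y: "y \<in> cent x"
      show "y \<in> Z \<union> (Z #> x)"
      proof (cases "y \<in> F")
        case True
        then show ?thesis using FZ y by blast
      next
        case False
        then have "y \<in> F #> x" using y cover cent_sub by blast
        then obtain f where f: "f \<in> F" "y = f \<otimes> x" by (auto simp: r_coset_def)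
        have fG: "f \<in> carrier G" using f FG by blast
        have "f = y \<otimes> inv x" using f(2) fG xG by (simp add: m_assoc)
        moreover have "y \<otimes> inv x \<in> cent x"
        proof -
          have "x \<in> cent x" using xG by (simp add: cent_def)
          then show ?thesis
            using y subgroup.m_closed[OF cent_subgroup[OF xG]] subgroup.m_inv_closed[OF cent_subgroup[OF xG]]
            by blast
        qed
        ultimately have "f \<in> Z" using FZ f(1) by simp
        then show ?thesis using f(2) by (auto simp: r_coset_def)
      qed
    next
      fix y assume "y \<in> Z \<union> (Z #> x)"
      moreover have "Z \<subseteq> cent x" using xG by (auto simp: Z_def)
      moreover have "x \<in> cent x" using xG by (simp add: cent_def)
      ultimately show "y \<in> cent x"
        using subgroup.m_closed[OF cent_subgroup[OF xG]] by (auto simp: r_coset_def)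
    qed
    moreover have "Z #> x \<subseteq> F #> x" using ZF by (auto simp: r_coset_def)
    then have "Z \<inter> (Z #> x) = {}" "finite (Z #> x)"
      using disj ZF sub by (blast, simp add: subset_trans)
    moreover have "finite Z" using ZF FG by simp
    ultimately show ?thesis using cZ by (simp add: card_Un_disjoint)
  qed
  have "card (F - Z) = card F - card Z" "card Z \<le> card F"
    using ZF FG by (auto intro: card_Diff_subset card_mono)
  then have e1: "real (card (F - Z)) = real (card F) - card Z" by linarith
  have "card (carrier G - F) = card (carrier G) - card F" using FG by (intro card_Diff_subset) auto
  then have e2: "card (carrier G - F) = card F" using F(2) unfolding order_def by linarith
  have split: "carrier G = Z \<union> (F - Z) \<union> (carrier G - F)" using ZF FG by blast
  have "(\<Sum>x\<in>carrier G. real (card (cent x))) =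
    (\<Sum>x\<in>Z. real (card (cent x))) + (\<Sum>x\<in>F - Z. real (card (cent x))) + (\<Sum>x\<in>carrier G - F. real (card (cent x)))"
  proof -
    have fi: "finite Z" "finite (F - Z)" "finite (carrier G - F)" using ZF FG by auto
    have "(\<Sum>x\<in>Z \<union> (F - Z) \<union> (carrier G - F). real (card (cent x))) =
      (\<Sum>x\<in>Z \<union> (F - Z). real (card (cent x))) + (\<Sum>x\<in>carrier G - F. real (card (cent x)))"
      using fi ZF by (intro sum.union_disjoint) auto
    also have "(\<Sum>x\<in>Z \<union> (F - Z). real (card (cent x))) =
      (\<Sum>x\<in>Z. real (card (cent x))) + (\<Sum>x\<in>F - Z. real (card (cent x)))"
      using fi by (intro sum.union_disjoint) auto
    finally show ?thesis using split by simp
  qed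
  also have "\<dots> = card Z * (2 * real (card F)) + card (F - Z) * real (card F) + card (carrier G - F) * (2 * real (card Z))"
    by (simp add: c1 c2 c3)
  finally have total: "(\<Sum>x\<in>carrier G. real (card (cent x))) =
    real (card (F - Z)) * real (card F) + card Z * (4 * real (card F))"
    unfolding e2 by simp
  have "commuting_prob G = (real (card F) * card F + 3 * card F * card Z) / (2 * real (card F))\<^sup>2"
    unfolding commuting_prob_sum F(2) total e1 by (simp add: algebra_simps)
  also have "\<dots> = 1 / 4 + 3 / (4 * real m)"
    unfolding m using mpos by (simp add: field_simps power2_eq_square)
  finally show ?thesis using mpos by blast
qed

text \<open>A pair outside \<open>F \<times> F\<close> has its first or its second entry outside
  \<open>F\<close>; each case has probability at most \<open>c\<close>.\<close>

lemma commuting_prob_le_restrict: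
  assumes F: "F \<subseteq> carrier G" and c: "0 < c" "\<And>x. x \<in> carrier G - F \<Longrightarrow> density (cent x) \<le> c"
  shows "commuting_prob G \<le> (\<Sum>x\<in>F. real (card (cent x \<inter> F))) / (real (order G))\<^sup>2 + 2 * c"
proof -
  let ?P = "{(x, y). x \<in> carrier G \<and> y \<in> carrier G \<and> x \<otimes> y = y \<otimes> x}"
  let ?A = "SIGMA x:F. cent x \<inter> F" and ?B = "SIGMA x:carrier G - F. cent x" and ?o = "real (order G)"
  have fi: "finite ?A" "finite ?B" using F by auto
  have "?P \<subseteq> ?A \<union> (?B \<union> prod.swap ` ?B)" by (force simp: cent_def)
  then have "card ?P \<le> card (?A \<union> (?B \<union> prod.swap ` ?B))"
    using fi by (intro card_mono) auto
  also have "\<dots> \<le> card ?A + (card ?B + card ?B)"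
    using card_Un_le[of ?A "?B \<union> prod.swap ` ?B"] card_Un_le[of ?B "prod.swap ` ?B"]
      card_image_le[OF fi(2), of prod.swap] by linarith
  finally have "real (card ?P) \<le> real (card ?A) + 2 * real (card ?B)" by linarith
  moreover have "real (card ?A) = (\<Sum>x\<in>F. real (card (cent x \<inter> F)))"
    using F by (subst card_SigmaI) auto
  moreover have "real (card ?B) \<le> c * ?o\<^sup>2"
  proof -
    have "real (card ?B) = (\<Sum>x\<in>carrier G - F. real (card (cent x)))"
      by (subst card_SigmaI) auto
    also have "\<dots> \<le> real (card (carrier G - F)) * (c * ?o)"
    proof (rule sum_bounded_above)
      fix x assume "x \<in> carrier G - F"
      then show "real (card (cent x)) \<le> c * ?o"
        using c(2)[of x] order_pos by (simp add: density_def field_simps)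
    qed
    also have "\<dots> \<le> ?o * (c * ?o)"
      using c(1) by (intro mult_right_mono) (auto simp: order_def card_mono)
    finally show ?thesis by (simp add: power2_eq_square mult_ac)
  qed
  ultimately have "real (card ?P) \<le> (\<Sum>x\<in>F. real (card (cent x \<inter> F))) + 2 * (c * ?o\<^sup>2)"
    by linarith
  then have "real (card ?P) / ?o\<^sup>2 \<le> ((\<Sum>x\<in>F. real (card (cent x \<inter> F))) + 2 * (c * ?o\<^sup>2)) / ?o\<^sup>2"
    by (rule divide_right_mono) simp
  then show ?thesis using order_pos by (simp add: commuting_prob_def add_divide_distrib)
qed

text \<open>The centre of \<open>F\<close> and the centralisers in \<open>F\<close> of noncentral
  elements each fill at most half of \<open>F\<close>, which gives the proportion
  \<open>1 / 2 + 1 / 2 * 1 / 2\<close>.\<close>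

lemma nonabelian_subgroup_pairs:
  assumes F: "subgroup F G" and nc: "a \<in> F" "b \<in> F" "a \<otimes> b \<noteq> b \<otimes> a"
  shows "(\<Sum>x\<in>F. real (card (cent x \<inter> F))) \<le> 3 / 4 * (real (card F))\<^sup>2"
proof -
  have FG: "F \<subseteq> carrier G" using F by (rule subgroup.subset)
  let ?f = "real (card F)"
  define C where "C = F \<inter> (\<Inter>g\<in>F. cent g)"
  have C: "subgroup C G" unfolding C_def using density_INT[of F F 0 cent] F FG by (auto simp: subset_iff)
  have CF: "C \<subseteq> F" by (auto simp: C_def)
  have "a \<notin> cent b" using nc FG by (auto simp: cent_def)
  then have "a \<notin> C" using nc(2) by (auto simp: C_def)
  then have "2 * card C \<le> card F" using CF nc(1) by (intro card_proper_subgroup C F) blast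
  then have cC: "real (card C) \<le> ?f / 2" by linarith
  have half: "real (card (cent x \<inter> F)) \<le> ?f / 2" if x: "x \<in> F - C" for x
  proof -
    have xG: "x \<in> carrier G" using x FG by blast
    have "cent x \<inter> F \<subset> F" using x FG cent_sym[OF xG] by (auto simp: C_def)
    then have "2 * card (cent x \<inter> F) \<le> card F"
      using xG F by (intro card_proper_subgroup subgroups_Inter_pair) auto
    then show ?thesis by linarith
  qed
  have fi: "finite F" using FG by simp
  have "(\<Sum>x\<in>F. real (card (cent x \<inter> F))) =
    (\<Sum>x\<in>F - C. real (card (cent x \<inter> F))) + (\<Sum>x\<in>C. real (card (cent x \<inter> F)))"
    using CF fi by (rule sum.subset_diff)
  also have "\<dots> \<le> real (card (F - C)) * (?f / 2) + real (card C) * ?f"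
    using half fi by (intro add_mono sum_bounded_above) (auto intro: card_mono)
  also have "real (card (F - C)) = ?f - card C"
    using CF fi by (simp add: card_Diff_subset finite_subset of_nat_diff card_mono)
  also have "(?f - card C) * (?f / 2) + real (card C) * ?f = (?f + card C) * (?f / 2)"
    by (simp add: field_simps)
  also have "\<dots> \<le> (?f + ?f / 2) * (?f / 2)" using cC by (intro mult_right_mono) auto
  finally show ?thesis by (simp add: power2_eq_square)
qed

text \<open>\<open>X\<close> collects the elements with at most 100 conjugates; pairs not inside a
  set containing \<open>X\<close> contribute at most \<open>2 * (1 / 100)\<close>. Products of five
  factors from \<open>X\<close> fill a subgroup, and \<open>100 ^ 5\<close> bounds their
  classes.\<close>

lemma commuting_prob_gt_two_ninths:
  assumes "2 / 9 < commuting_prob G"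
  shows "(\<forall>x\<in>carrier G. card (cmt x ` carrier G) \<le> 100 ^ 5) \<or>
    (\<exists>m>0. commuting_prob G = 1 / 4 + 3 / (4 * real m))"
proof -
  let ?o = "real (order G)"
  define X where "X = {x \<in> carrier G. 1 / 100 \<le> density (cent x)}"
  have X: "X \<subseteq> carrier G" "\<And>x. x \<in> X \<Longrightarrow> 1 / 100 \<le> density (cent x)"
    by (auto simp: X_def)
  have outside: "commuting_prob G \<le> (\<Sum>x\<in>F. real (card (cent x \<inter> F))) / ?o\<^sup>2 + 1 / 50"
    if "X \<subseteq> F" "F \<subseteq> carrier G" for F
    using commuting_prob_le_restrict[OF that(2), of "1 / 100"] that(1) by (force simp: X_def)
  have fX: "finite X" using X(1) by simp
  have "(\<Sum>x\<in>X. real (card (cent x \<inter> X))) \<le> real (card X) * real (card X)"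
    using fX by (intro sum_bounded_above) (auto intro: card_mono)
  then have "(\<Sum>x\<in>X. real (card (cent x \<inter> X))) / ?o\<^sup>2 \<le> real (card X) * real (card X) / ?o\<^sup>2"
    by (rule divide_right_mono) simp
  also have "\<dots> = (density X)\<^sup>2" by (simp add: density_def power2_eq_square)
  finally have "2 / 9 < (density X)\<^sup>2 + 1 / 50"
    using outside[OF order_refl X(1)] assms by linarith
  \<comment> \<open>Already \<open>2 / 9 - 1 / 50\<close> exceeds \<open>1 / 9\<close>, so
    \<open>X\<close> passes the one-third threshold of \<open>set_power_stable\<close>.\<close>
  then have "(1 / 3)\<^sup>2 < (density X)\<^sup>2" by (simp add: power2_eq_square)
  then have "1 / 3 < density X" by (rule power2_less_imp_less) simp
  then have big: "order G < 3 * card X" using order_pos by (simp add: density_def field_simps)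
  have "cent \<one> = carrier G" by (auto simp: cent_def)
  then have one: "\<one> \<in> X" by (simp add: X_def)
  have inv: "inv x \<in> X" if x: "x \<in> X" for x
  proof -
    have xG: "x \<in> carrier G" using x X(1) by blast
    have "cent x \<subseteq> cent (inv x)"
    proof
      fix y assume y: "y \<in> cent x"
      then have yG: "y \<in> carrier G" using cent_sub by blast
      have "inv x \<in> cent y"
        using subgroup.m_inv_closed[OF cent_subgroup[OF yG] cent_sym[OF xG y]] .
      then show "y \<in> cent (inv x)" using cent_sym[OF yG] by blast
    qed
    then have "density (cent x) \<le> density (cent (inv x))" by (rule density_mono) simp
    then show ?thesis using x xG by (simp add: X_def)
  qed
  define F where "F = set_power X 5"
  have F: "subgroup F G" unfolding F_def by (rule set_power_subgroup[OF X(1) one inv big])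
  have FG: "F \<subseteq> carrier G" using F by (rule subgroup.subset)
  have XF: "X \<subseteq> F"
  proof
    fix x assume x: "x \<in> X"
    have "\<one> \<in> set_power X n" for n
      by (induction n) (use one in \<open>auto intro!: image_eqI[of _ _ "(\<one>, \<one>)"]\<close>)
    then have "x \<otimes> \<one> \<in> set_power X (Suc 4)" unfolding set_power.simps using x by blast
    then show "x \<in> F" using x X(1) by (auto simp: F_def simp flip: eval_nat_numeral)
  qed
  show ?thesis
  proof (cases "F = carrier G")
    case True
    have "card (cmt x ` carrier G) \<le> 100 ^ 5" if x: "x \<in> carrier G" for x
    proof -
      have "(1 / 100) ^ 5 \<le> density (cent x)"
        using set_power_cent_density[OF X, of x 5] x True by (simp add: F_def)
      then have "?o \<le> 100 ^ 5 * real (card (cent x))"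
        using order_pos by (simp add: density_def field_simps)
      then have "real (card (cmt x ` carrier G)) * real (card (cent x)) \<le> 100 ^ 5 * real (card (cent x))"
        using order_eq_card_cent[OF x] by simp
      moreover have "real (card (cent x)) > 0"
        using order_eq_card_cent[OF x] order_pos by (cases "card (cent x)") auto
      ultimately have "real (card (cmt x ` carrier G)) \<le> 100 ^ 5"
        by (simp only: mult_le_cancel_right_pos)
      then show ?thesis by simp
    qed
    then show ?thesis by blast
  next
    case False
    \<comment> \<open>\<open>F\<close> contains \<open>X\<close>, more than a third of the group, so
      its index is below three; it is proper, so the index is two.\<close>
    have "order G = 2 * card F"
    proof -
      have l: "card (rcosets F) * card F = order G" by (rule lagrange[OF F])
      have "2 * card F \<le> order G"
        unfolding order_def using False FG by (intro card_proper_subgroup F subgroup_self) blast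
      moreover have "card X \<le> card F" using XF FG by (intro card_mono) auto
      then have "order G < 3 * card F" using big by linarith
      ultimately have "2 * card F \<le> card (rcosets F) * card F" "card (rcosets F) * card F < 3 * card F"
        using l by simp_all
      then have "2 \<le> card (rcosets F)" "card (rcosets F) < 3" by auto
      then have "card (rcosets F) = 2" by linarith
      then show ?thesis using l by simp
    qed
    moreover have "a \<otimes> b = b \<otimes> a" if "a \<in> F" "b \<in> F" for a b
    proof (rule ccontr)
      assume "a \<otimes> b \<noteq> b \<otimes> a"
      then have "(\<Sum>x\<in>F. real (card (cent x \<inter> F))) \<le> 3 / 4 * (real (card F))\<^sup>2"
        using nonabelian_subgroup_pairs[OF F that] by blast
      also have "\<dots> = 3 / 16 * ?o\<^sup>2" using \<open>order G = 2 * card F\<close> by simp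
      finally have "(\<Sum>x\<in>F. real (card (cent x \<inter> F))) / ?o\<^sup>2 \<le> 3 / 16"
        using order_pos by (simp add: field_simps)
      \<comment> \<open>The contradiction is \<open>3 / 16 + 1 / 50 < 2 / 9\<close>.\<close>
      then show False using outside[OF XF FG] assms by linarith
    qed
    ultimately show ?thesis using commuting_prob_abelian_index_2[OF F] by blast
  qed
qed

end

section \<open>Limit points above two ninths\<close>

lemma commuting_probs_gt_two_ninths:
  "\<exists>m \<eta>. 0 < \<eta> \<and> {p \<in> commuting_probs. 2 / 9 < p} \<subseteq>
    almost_central_probs m \<eta> \<union> {1 / 4 + 3 / (4 * real m) | m :: nat. 0 < m}"
proof -
  \<comment> \<open>Fixing \<open>k\<close> before any group is chosen makes the parameters of
    \<open>almost_central_probs\<close> uniform.\<close>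
  define k :: nat where "k = 100 ^ 5"
  have "0 < k" by (simp add: k_def)
  have "p \<in> almost_central_probs ((k\<^sup>2) ^ 2 ^ k\<^sup>2) (bfc_density k) \<union> {1 / 4 + 3 / (4 * real m) | m :: nat. 0 < m}"
    if p: "p \<in> commuting_probs" "2 / 9 < p" for p
  proof -
    obtain G :: "nat monoid" where G: "group G" "finite (carrier G)" "p = commuting_prob G"
      using p(1) unfolding commuting_probs_def by blast
    interpret group G by fact
    interpret fin_group G by unfold_locales fact
    consider "\<forall>x\<in>carrier G. card (cmt x ` carrier G) \<le> k"
      | "\<exists>m>0. commuting_prob G = 1 / 4 + 3 / (4 * real m)"
      using commuting_prob_gt_two_ninths p(2) G(3) unfolding k_def by blast
    then show ?thesis
    proof cases
      case 1
      then have "\<exists>N. N \<lhd> G \<and> card N \<le> (k\<^sup>2) ^ 2 ^ k\<^sup>2 \<and> bfc_density k \<le> density (zmod N)"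
        by (intro bfc) blast
      then show ?thesis using G unfolding almost_central_probs_def by blast
    next
      case 2
      then show ?thesis using G(3) by blast
    qed
  qed
  then show ?thesis using bfc_density_pos[OF \<open>0 < k\<close>] by blast
qed

theorem mainTheorem1:
  fixes l :: real
  assumes "l \<in> {2 / 9 <.. 1}"
    and "is_limit_point l commuting_probs"
  shows "l \<in> \<rat> \<and> (\<exists>\<epsilon>>0. commuting_probs \<inter> {l - \<epsilon> <..< l} = {})"
proof -
  let ?P = "{p \<in> commuting_probs. 2 / 9 < p}"
  obtain m \<eta> where "0 < \<eta>" and
    "?P \<subseteq> almost_central_probs m \<eta> \<union> {1 / 4 + 3 / (4 * real m) | m :: nat. 0 < m}"
    using commuting_probs_gt_two_ninths by blast
  then have P: "rational_from_above ?P"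
    using rational_from_above_Un[OF almost_central_rational_from_above rational_from_above_quarter]
      rational_from_above_mono by blast
  have l: "2 / 9 < l" using assms(1) by simp
  \<comment> \<open>Terms tending to \<open>l\<close> eventually exceed \<open>2 / 9\<close>, which
    confines the argument to \<open>?P\<close>.\<close>
  have gap: "\<forall>\<^sub>F n in sequentially. s n \<in> ?P"
    if "\<forall>n. s n \<in> commuting_probs" "s \<longlonglongrightarrow> l" for s
    using order_tendstoD(1)[OF that(2) l] that(1) by (auto elim: eventually_mono)
  have limit: "l \<in> \<rat> \<and> (\<exists>n. l \<le> s n)"
    if s: "\<forall>n. s n \<in> commuting_probs" "s \<longlonglongrightarrow> l" for s
  proof -
    have "infinite {n. s n \<in> ?P}" using gap[OF s] by (rule eventually_infinite)
    then show ?thesis using rational_from_above_infinite[OF P _ s(2)] by blast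
  qed
  have "\<exists>\<epsilon>>0. commuting_probs \<inter> {l - \<epsilon> <..< l} = {}"
  proof (rule ccontr)
    assume "\<not> ?thesis"
    then have near: "\<exists>p. p \<in> commuting_probs \<and> l - \<epsilon> < p \<and> p < l"
      if "0 < \<epsilon>" for \<epsilon>
      using that by fastforce
    \<comment> \<open>Without a gap, points chosen ever closer below \<open>l\<close> form a
      sequence that tends to \<open>l\<close> with no term at or above it.\<close>
    have "\<forall>n. \<exists>p. p \<in> commuting_probs \<and> l - inverse (real (Suc n)) < p \<and> p < l"
      by (intro allI near) simp
    then obtain s where s: "\<And>n. s n \<in> commuting_probs"
      "\<And>n. l - inverse (real (Suc n)) < s n" "\<And>n. s n < l" by metis
    have "(\<lambda>n. l - inverse (real (Suc n))) \<longlonglongrightarrow> l - 0"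
      by (intro tendsto_diff tendsto_const LIMSEQ_inverse_real_of_nat)
    then have "s \<longlonglongrightarrow> l"
      using s(2,3) by (intro tendsto_sandwich[of "\<lambda>n. l - inverse (real (Suc n))" s _ "\<lambda>_. l"])
        (auto intro: always_eventually less_imp_le)
    then show False using limit[of s] s(1,3) not_less by blast
  qed
  moreover have "l \<in> \<rat>" using limit assms(2) unfolding is_limit_point_def by blast
  ultimately show ?thesis by blast
qed

end
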